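(* If $A$ is a finitely generated group with finite abelianisation and $B$ is a finite group, then the wreath product $A\wr B$ has property $\mathrm{Fix}_d$ for $d=|B|-1$.
   Context: For $B$ finite, $A\wr B=\left(\bigoplus_{b\in B}A_b\right)\rtimes B$ where each $A_b$ is a copy of $A$, with fixed isomorphisms $\mu_b:A\to A_b$, and $b\in B$ acts by permuting the factors via $\mu_{bb'}\circ\mu_{b'}^{-1}:A_{b'}\to A_{bb'}$. An isometry $\gamma$ of a metric space $X$ is semisimple if the infimum $\inf\{d(x,\gamma x)\mid x\in X\}$ is attained at some point of $X$. A group $G$ has property $\mathrm{Fix}_d$ if $G$ fixes a point whenever it acts by semisimple isometries (i.e. every element acts as a semisimple isometry) on a complete CAT$(0)$ space of dimension at most $d$. *)

theory Defs
  imports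
    "HOL-Analysis.Analysis"
    "HOL-Algebra.Product_Groups"
    "HOL-Algebra.Generated_Groups"
    "HOL-Algebra.Group_Action"
begin

section \<open>Groups\<close>

definition finitely_generated_group :: "('a, 'm) monoid_scheme \<Rightarrow> bool" where
  "finitely_generated_group G \<longleftrightarrow>
     group G \<and> (\<exists>S. finite S \<and> S \<subseteq> carrier G \<and> generate G S = carrier G)"

definition abelianisation :: "('a, 'm) monoid_scheme \<Rightarrow> 'a set monoid" where
  "abelianisation G = G Mod derived G (carrier G)"

definition semidirect_product ::
  "('n, 'm) monoid_scheme \<Rightarrow> ('h, 'k) monoid_scheme \<Rightarrow> ('h \<Rightarrow> 'n \<Rightarrow> 'n) \<Rightarrow> ('n \<times> 'h) monoid" where
  "semidirect_product N H \<alpha> =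
     \<lparr>carrier = carrier N \<times> carrier H,
      monoid.mult = (\<lambda>(n, h) (n', h'). (n \<otimes>\<^bsub>N\<^esub> \<alpha> h n', h \<otimes>\<^bsub>H\<^esub> h')),
      one = (\<one>\<^bsub>N\<^esub>, \<one>\<^bsub>H\<^esub>)\<rparr>"

text \<open>
  The direct sum is a group of functions on \<^term>\<open>carrier B\<close>, the summand with index \<^term>\<open>b'\<close>
  consisting of the functions supported at \<^term>\<open>b'\<close>.  The element \<^term>\<open>b\<close> moves this summand
  to the one with index \<^term>\<open>b \<otimes>\<^bsub>B\<^esub> b'\<close>; see \<open>wreath_shift_summand\<close> below.
\<close>

definition wreath_shift :: "('b, 'n) monoid_scheme \<Rightarrow> 'b \<Rightarrow> ('b \<Rightarrow> 'a) \<Rightarrow> 'b \<Rightarrow> 'a" where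
  "wreath_shift B b f = (\<lambda>x \<in> carrier B. f (inv\<^bsub>B\<^esub> b \<otimes>\<^bsub>B\<^esub> x))"

definition wreath_product ::
  "('a, 'm) monoid_scheme \<Rightarrow> ('b, 'n) monoid_scheme \<Rightarrow> (('b \<Rightarrow> 'a) \<times> 'b) monoid" where
  "wreath_product A B = semidirect_product (sum_group (carrier B) (\<lambda>_. A)) B (wreath_shift B)"

definition wreath_summand ::
  "('a, 'm) monoid_scheme \<Rightarrow> ('b, 'n) monoid_scheme \<Rightarrow> 'b \<Rightarrow> 'a \<Rightarrow> 'b \<Rightarrow> 'a" where
  "wreath_summand A B b a = (\<lambda>x \<in> carrier B. if x = b then a else \<one>\<^bsub>A\<^esub>)"

lemma wreath_shift_summand:
  assumes "group B" "b \<in> carrier B" "b' \<in> carrier B"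
  shows "wreath_shift B b (wreath_summand A B b' a) = wreath_summand A B (b \<otimes>\<^bsub>B\<^esub> b') a"
proof -
  interpret B: group B by fact
  have "inv\<^bsub>B\<^esub> b \<otimes>\<^bsub>B\<^esub> x = b' \<longleftrightarrow> x = b \<otimes>\<^bsub>B\<^esub> b'" if "x \<in> carrier B" for x
  proof
    assume "inv\<^bsub>B\<^esub> b \<otimes>\<^bsub>B\<^esub> x = b'"
    then show "x = b \<otimes>\<^bsub>B\<^esub> b'"
      using that assms by (auto simp flip: B.m_assoc)
  next
    assume "x = b \<otimes>\<^bsub>B\<^esub> b'"
    then show "inv\<^bsub>B\<^esub> b \<otimes>\<^bsub>B\<^esub> x = b'"
      using that assms by (simp flip: B.m_assoc)
  qed
  then show ?thesis
    using assms unfolding wreath_shift_def wreath_summand_def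
    by (intro restrict_ext) simp
qed

lemma group_semidirect_product:
  assumes "group N" "group H"
    and hom: "\<And>h. h \<in> carrier H \<Longrightarrow> \<alpha> h \<in> hom N N"
    and one: "\<And>n. n \<in> carrier N \<Longrightarrow> \<alpha> \<one>\<^bsub>H\<^esub> n = n"
    and mult: "\<And>g h n. \<lbrakk>g \<in> carrier H; h \<in> carrier H; n \<in> carrier N\<rbrakk>
                 \<Longrightarrow> \<alpha> (g \<otimes>\<^bsub>H\<^esub> h) n = \<alpha> g (\<alpha> h n)"
  shows "group (semidirect_product N H \<alpha>)"
proof -
  interpret N: group N by fact
  interpret H: group H by fact
  have cl: "\<alpha> h n \<in> carrier N" if "h \<in> carrier H" "n \<in> carrier N" for h n
    using hom[OF that(1)] that(2) by (auto simp: hom_def)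
  have dist: "\<alpha> h (m \<otimes>\<^bsub>N\<^esub> n) = \<alpha> h m \<otimes>\<^bsub>N\<^esub> \<alpha> h n"
    if "h \<in> carrier H" "m \<in> carrier N" "n \<in> carrier N" for h m n
    using hom[OF that(1)] that(2,3) by (auto simp: hom_def)
  show ?thesis
  proof (rule groupI)
    fix x assume "x \<in> carrier (semidirect_product N H \<alpha>)"
    then obtain n h where x: "x = (n, h)" "n \<in> carrier N" "h \<in> carrier H"
      by (auto simp: semidirect_product_def)
    let ?y = "(\<alpha> (inv\<^bsub>H\<^esub> h) (inv\<^bsub>N\<^esub> n), inv\<^bsub>H\<^esub> h)"
    have "\<alpha> (inv\<^bsub>H\<^esub> h) (inv\<^bsub>N\<^esub> n) \<otimes>\<^bsub>N\<^esub> \<alpha> (inv\<^bsub>H\<^esub> h) n = \<alpha> (inv\<^bsub>H\<^esub> h) \<one>\<^bsub>N\<^esub>"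
      using x dist[of "inv\<^bsub>H\<^esub> h" "inv\<^bsub>N\<^esub> n" n] by simp
    also have "\<dots> = \<one>\<^bsub>N\<^esub>"
      using x hom_one[OF hom] assms by simp
    finally have "?y \<otimes>\<^bsub>semidirect_product N H \<alpha>\<^esub> x = \<one>\<^bsub>semidirect_product N H \<alpha>\<^esub>"
      using x by (simp add: semidirect_product_def)
    then show "\<exists>y\<in>carrier (semidirect_product N H \<alpha>).
        y \<otimes>\<^bsub>semidirect_product N H \<alpha>\<^esub> x = \<one>\<^bsub>semidirect_product N H \<alpha>\<^esub>"
      by (rule rev_bexI[rotated]) (use x cl in \<open>simp add: semidirect_product_def\<close>)
  qed (auto simp: semidirect_product_def cl dist one mult N.m_assoc H.m_assoc)
qed

lemma group_wreath_product:
  assumes "group A" "group B" and fin: "finite (carrier B)"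
  shows "group (wreath_product A B)"
proof -
  interpret A: group A by fact
  interpret B: group B by fact
  let ?S = "sum_group (carrier B) (\<lambda>_. A)"
  have carr: "carrier ?S = carrier B \<rightarrow>\<^sub>E carrier A"
    using fin by (auto simp: carrier_sum_group)
  show ?thesis
    unfolding wreath_product_def
  proof (rule group_semidirect_product)
    show "wreath_shift B b \<in> hom ?S ?S" if b: "b \<in> carrier B" for b
    proof (rule homI)
      fix f assume "f \<in> carrier ?S"
      then have "f y \<in> carrier A" if "y \<in> carrier B" for y
        using that PiE_mem[of f "carrier B" "\<lambda>_. carrier A" y] unfolding carr by blast
      then show "wreath_shift B b f \<in> carrier ?S"
        using b unfolding carr wreath_shift_def restrict_PiE_iff by simp
    next
      fix f g
      show "wreath_shift B b (f \<otimes>\<^bsub>?S\<^esub> g) = wreath_shift B b f \<otimes>\<^bsub>?S\<^esub> wreath_shift B b g"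
        using b unfolding wreath_shift_def mult_sum_group by (intro restrict_ext) simp
    qed
    show "wreath_shift B \<one>\<^bsub>B\<^esub> f = f" if "f \<in> carrier ?S" for f
    proof
      fix x
      show "wreath_shift B \<one>\<^bsub>B\<^esub> f x = f x"
        using that PiE_arb[of f "carrier B"] unfolding carr wreath_shift_def
        by (cases "x \<in> carrier B") simp_all
    qed
    show "wreath_shift B (g \<otimes>\<^bsub>B\<^esub> h) f = wreath_shift B g (wreath_shift B h f)"
      if "g \<in> carrier B" "h \<in> carrier B" for g h f
      using that unfolding wreath_shift_def
      by (intro restrict_ext) (simp add: B.inv_mult_group B.m_assoc)
  qed (simp_all add: A.group_axioms B.group_axioms)
qed


section \<open>CAT(0) spaces\<close>

context Metric_space
begin

definition geodesic_segment :: "'a set \<Rightarrow> 'a \<Rightarrow> 'a \<Rightarrow> bool" where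
  "geodesic_segment S x y \<longleftrightarrow>
     (\<exists>c. c ` {0..d x y} = S \<and> S \<subseteq> M \<and> c 0 = x \<and> c (d x y) = y \<and>
          (\<forall>s\<in>{0..d x y}. \<forall>t\<in>{0..d x y}. d (c s) (c t) = \<bar>s - t\<bar>))"

text \<open>
  Pairs of a point on the side \<^term>\<open>S\<close> from \<^term>\<open>p\<close> to \<^term>\<open>q\<close> of a geodesic triangle and its
  comparison point on the corresponding side of a comparison triangle in the Euclidean plane.
\<close>

definition comparison_pairs ::
  "'a set \<Rightarrow> 'a \<Rightarrow> 'a \<Rightarrow> (real^2) \<Rightarrow> (real^2) \<Rightarrow> ('a \<times> (real^2)) set" where
  "comparison_pairs S p q p' q' =
     {(x, x'). x \<in> S \<and> x' \<in> closed_segment p' q' \<and> dist p' x' = d p x \<and> dist x' q' = d x q}"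

definition triangle_comparison_pairs ::
  "'a set \<Rightarrow> 'a set \<Rightarrow> 'a set \<Rightarrow> 'a \<Rightarrow> 'a \<Rightarrow> 'a \<Rightarrow> (real^2) \<Rightarrow> (real^2) \<Rightarrow> (real^2) \<Rightarrow>
   ('a \<times> (real^2)) set" where
  "triangle_comparison_pairs S T U p q r p' q' r' =
     comparison_pairs S p q p' q' \<union> comparison_pairs T q r q' r' \<union> comparison_pairs U r p r' p'"

definition isometry_of :: "('a \<Rightarrow> 'a) \<Rightarrow> bool" where
  "isometry_of \<gamma> \<longleftrightarrow> bij_betw \<gamma> M M \<and> (\<forall>x\<in>M. \<forall>y\<in>M. d (\<gamma> x) (\<gamma> y) = d x y)"

definition semisimple_isometry :: "('a \<Rightarrow> 'a) \<Rightarrow> bool" where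
  "semisimple_isometry \<gamma> \<longleftrightarrow>
     isometry_of \<gamma> \<and> (\<exists>x\<in>M. d x (\<gamma> x) = (INF y\<in>M. d y (\<gamma> y)))"

end

text \<open>CAT(0) spaces are required to be nonempty: the empty space has no fixed point.\<close>

locale CAT0_space = Metric_space +
  assumes nonempty: "M \<noteq> {}"
    and geodesic: "\<lbrakk>x \<in> M; y \<in> M\<rbrakk> \<Longrightarrow> \<exists>S. geodesic_segment S x y"
    and CAT0_inequality:
      "\<lbrakk>p \<in> M; q \<in> M; r \<in> M;
        geodesic_segment S p q; geodesic_segment T q r; geodesic_segment U r p;
        dist p' q' = d p q; dist q' r' = d q r; dist r' p' = d r p;
        (x, x') \<in> triangle_comparison_pairs S T U p q r p' q' r';
        (y, y') \<in> triangle_comparison_pairs S T U p q r p' q' r'\<rbrakk>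
       \<Longrightarrow> d x y \<le> dist x' y'"


section \<open>Covering dimension and the property Fix\<close>

text \<open>
  Dimension means Lebesgue covering dimension.  The covers are arbitrary rather than finite, which
  makes no difference for metrisable spaces.
\<close>

definition covering_dim_le :: "'a topology \<Rightarrow> nat \<Rightarrow> bool" where
  "covering_dim_le X n \<longleftrightarrow>
     (\<forall>\<U>. (\<forall>U\<in>\<U>. openin X U) \<and> \<Union>\<U> = topspace X \<longrightarrow>
        (\<exists>\<V>. (\<forall>V\<in>\<V>. openin X V) \<and> \<Union>\<V> = topspace X \<and>
             (\<forall>V\<in>\<V>. \<exists>U\<in>\<U>. V \<subseteq> U) \<and>
             (\<forall>x\<in>topspace X. finite {V\<in>\<V>. x \<in> V} \<and> card {V\<in>\<V>. x \<in> V} \<le> n + 1)))"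

text \<open>
  The spaces are carried by arbitrary subsets of the type \<^typ>\<open>'x\<close>, which has to be an explicit
  parameter.  A theorem with \<^typ>\<open>'x\<close> as a type variable covers all complete CAT(0) spaces.
\<close>

definition property_Fix :: "'x itself \<Rightarrow> nat \<Rightarrow> ('g, 'm) monoid_scheme \<Rightarrow> bool" where
  "property_Fix _ n G \<longleftrightarrow>
     (\<forall>(M :: 'x set) d \<phi>.
        CAT0_space M d \<and> Metric_space.mcomplete M d \<and>
        covering_dim_le (Metric_space.mtopology M d) n \<and>
        group_action G M \<phi> \<and>
        (\<forall>g\<in>carrier G. Metric_space.semisimple_isometry M d (\<phi> g))
        \<longrightarrow> (\<exists>x\<in>M. \<forall>g\<in>carrier G. \<phi> g x = x))"

end

theory Submission
  imports Defs
begin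

text \<open>
  Write \<open>n = |B|\<close> and let the \<open>n\<close> commuting copies of \<open>A\<close> act on the CAT(0) space.  If a copy fixes
  no point, there are two disjoint closed convex sets which are invariant under the other copies
  and meet every nonempty closed convex set that the copy preserves: fixed point sets of two parts
  of a minimal set of generators without common fixed point, or, if the copy contains a hyperbolic
  element, two opposite horoballs.  The horoballs are invariant because a commuting group changes a
  Busemann function by a homomorphism to the reals, which vanishes on a group with finite
  abelianisation.  If no copy fixes a point, any choice of one set from each of the \<open>n\<close> pairs has a
  common point.  These points span a singular \<open>n\<close>-cube whose opposite faces lie in disjoint closed
  sets, so by Lebesgue's covering theorem the space has dimension at least \<open>n\<close>.  Hence one copy, and
  by conjugation every copy, fixes a point; projections and barycentres give a global fixed point.
\<close>

section \<open>Lebesgue covering of the cube\<close>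

text \<open>A copy of \<open>A\<close> can lack a fixed point for two unrelated reasons: a
  hyperbolic element, or elliptic elements without a common fixed point. Semisimplicity excludes
  parabolic elements; finite generation serves the elliptic case, the finite abelianisation the
  hyperbolic one. Both are brought to one form because only three properties of a pair matter later:
  it is disjoint, each member is invariant under the commuting copies, and each member meets
  whatever closed convex set its own copy preserves. The last two allow the sets to be intersected
  one copy at a time, since the intersection reached so far is preserved by the next copy.

  The cube may be far from injective. This does no harm: the covering argument pulls functions on
  the space back to the cube and asks only that opposite faces go into disjoint closed sets. With
  \<open>n\<close> pairs it finds a point in \<open>n + 1\<close> members of a refinement, which is
  where the bound \<open>|B| - 1\<close> comes from.\<close>

lemma tendsto_fun_iff:
  fixes f :: "'a \<Rightarrow> 'i \<Rightarrow> 'b::topological_space"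
  shows "(f \<longlongrightarrow> l) F \<longleftrightarrow> (\<forall>i. ((\<lambda>x. f x i) \<longlongrightarrow> l i) F)"
proof -
  have "limitin euclidean f l F \<longleftrightarrow> (\<forall>i. limitin euclidean (\<lambda>x. f x i) (l i) F)"
    unfolding euclidean_product_topology[symmetric]
    by (simp add: limitin_componentwise)
  then show ?thesis by simp
qed

lemma compact_Pi_UNIV:
  fixes S :: "'i \<Rightarrow> 'b::topological_space set"
  assumes "\<And>i. compact (S i)"
  shows "compact (Pi UNIV S)"
proof -
  have "compactin (product_topology (\<lambda>i. euclidean) UNIV) (PiE UNIV S)"
    unfolding compactin_PiE using assms by simp
  then show ?thesis
    by (simp add: euclidean_product_topology PiE_UNIV_domain)
qed

text \<open>Kuhn's combinatorial lemma finds, in a grid of mesh \<open>1 / p\<close>, a cell on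
  which every \<open>g i\<close> takes both signs, 0 counting as either; a limit point of such cells
  as \<open>p\<close> grows is the zero. Points are sequences so that one type serves all
  \<open>n\<close>; grid points are 0 from coordinate \<open>n\<close> on, and \<open>K\<close> is
  compact by Tychonoff.\<close>

lemma poincare_miranda:
  fixes g :: "nat \<Rightarrow> (nat \<Rightarrow> real) \<Rightarrow> real"
  defines "K \<equiv> UNIV \<rightarrow> {0..1}"
  assumes cont: "\<And>i. i < n \<Longrightarrow> continuous_on K (g i)"
    and lower: "\<And>i x. \<lbrakk>i < n; x \<in> K; x i = 0\<rbrakk> \<Longrightarrow> 0 \<le> g i x"
    and upper: "\<And>i x. \<lbrakk>i < n; x \<in> K; x i = 1\<rbrakk> \<Longrightarrow> g i x \<le> 0"
  obtains x where "x \<in> K" "\<And>i. i < n \<Longrightarrow> g i x = 0"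
proof -
  define pt :: "nat \<Rightarrow> (nat \<Rightarrow> nat) \<Rightarrow> nat \<Rightarrow> real"
    where "pt p x = (\<lambda>i. if i < n then real (x i) / real p else 0)" for p x
  have ptK: "pt p x \<in> K" if "\<forall>i<n. x i \<le> p" "0 < p" for p x
    using that by (auto simp: K_def pt_def)
  have ex: "\<exists>q. (\<forall>i<n. q i < Suc m) \<and> (\<forall>i<n. \<exists>r s.
      (\<forall>j<n. q j \<le> r j \<and> r j \<le> q j + 1) \<and> (\<forall>j<n. q j \<le> s j \<and> s j \<le> q j + 1) \<and>
      0 \<le> g i (pt (Suc m) r) \<and> g i (pt (Suc m) s) \<le> 0)" for m
  proof -
    define p where "p = Suc m"
    \<comment> \<open>Kuhn's lemma prescribes the labels on the faces \<open>x i = 0\<close> and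
      \<open>x i = p\<close>; \<open>lower\<close> and \<open>upper\<close> keep the label a true
      record of the sign there.\<close>
    define label where "label x i = (if x i = 0 then 0 else if x i = p then 1
        else if 0 \<le> g i (pt p x) then 0 else (1::nat))" for x i
    have lab0: "0 \<le> g i (pt p x)" if "label x i = 0" "i < n" "\<forall>i<n. x i \<le> p" for x i
      using that lower[of i "pt p x"] ptK[of x p]
      by (auto simp: label_def p_def pt_def split: if_splits)
    have lab1: "g i (pt p x) \<le> 0" if "label x i \<noteq> 0" "i < n" "\<forall>i<n. x i \<le> p" for x i
      using that upper[of i "pt p x"] ptK[of x p]
      by (auto simp: label_def p_def pt_def split: if_splits)
    obtain q where q: "\<forall>i<n. q i < p"
      and rs: "\<forall>i<n. \<exists>r s. (\<forall>j<n. q j \<le> r j \<and> r j \<le> q j + 1) \<and>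
        (\<forall>j<n. q j \<le> s j \<and> s j \<le> q j + 1) \<and> label r i \<noteq> label s i"
      by (rule kuhn_lemma[of p n label]) (auto simp: label_def p_def)
    have "\<exists>r s. (\<forall>j<n. q j \<le> r j \<and> r j \<le> q j + 1) \<and> (\<forall>j<n. q j \<le> s j \<and> s j \<le> q j + 1) \<and>
        0 \<le> g i (pt p r) \<and> g i (pt p s) \<le> 0" if "i < n" for i
    proof -
      obtain r s where r: "\<forall>j<n. q j \<le> r j \<and> r j \<le> q j + 1"
        and s: "\<forall>j<n. q j \<le> s j \<and> s j \<le> q j + 1" and ne: "label r i \<noteq> label s i"
        using rs \<open>i < n\<close> by blast
      have r': "\<forall>j<n. r j \<le> p" and s': "\<forall>j<n. s j \<le> p"
        using r s q by fastforce+
      show ?thesis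
      proof (cases "label r i = 0")
        case True
        then have "label s i \<noteq> 0" using ne by simp
        then show ?thesis using r s lab0[OF True \<open>i < n\<close> r'] lab1[OF _ \<open>i < n\<close> s'] by blast
      next
        case False
        then have "label s i = 0" using ne by (auto simp: label_def split: if_splits)
        then show ?thesis using r s lab1[OF False \<open>i < n\<close> r'] lab0[OF _ \<open>i < n\<close> s'] by blast
      qed
    qed
    then show ?thesis using q unfolding p_def by blast
  qed
  then obtain q where q: "\<And>m i. i < n \<Longrightarrow> q m i < Suc m"
    and rs: "\<And>m i. i < n \<Longrightarrow> \<exists>r s. (\<forall>j<n. q m j \<le> r j \<and> r j \<le> q m j + 1) \<and>
      (\<forall>j<n. q m j \<le> s j \<and> s j \<le> q m j + 1) \<and>
      0 \<le> g i (pt (Suc m) r) \<and> g i (pt (Suc m) s) \<le> 0"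
    by metis
  have "compact K"
    unfolding K_def by (intro compact_Pi_UNIV compact_Icc)
  moreover have "\<forall>m. pt (Suc m) (q m) \<in> K"
    using q by (auto intro!: ptK less_imp_le)
  ultimately obtain x \<sigma> where x: "x \<in> K" and \<sigma>: "strict_mono (\<sigma> :: nat \<Rightarrow> nat)"
    and lim: "((\<lambda>m. pt (Suc m) (q m)) \<circ> \<sigma>) \<longlonglongrightarrow> x"
    unfolding compact_def by metis
  \<comment> \<open>Points of one cell differ by at most \<open>1 / p\<close> in each coordinate, so
    any choice of them converges to the same \<open>x\<close> as the base corners.\<close>
  have lim_near: "(\<lambda>m. pt (Suc (\<sigma> m)) (r m)) \<longlonglongrightarrow> x"
    if r: "\<forall>m. \<forall>j<n. q (\<sigma> m) j \<le> r m j \<and> r m j \<le> q (\<sigma> m) j + 1" for r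
    unfolding tendsto_fun_iff
  proof
    fix i
    have "(\<lambda>m. pt (Suc (\<sigma> m)) (q (\<sigma> m)) i) \<longlonglongrightarrow> x i"
      using lim unfolding tendsto_fun_iff by (simp add: comp_def)
    moreover have "(\<lambda>m. pt (Suc (\<sigma> m)) (r m) i - pt (Suc (\<sigma> m)) (q (\<sigma> m)) i) \<longlonglongrightarrow> 0"
    proof (rule tendsto_sandwich[where f = "\<lambda>_. 0" and h = "\<lambda>m. inverse (real (Suc (\<sigma> m)))"])
      have "(\<lambda>m. inverse (real (Suc m))) \<longlonglongrightarrow> 0" by (rule LIMSEQ_inverse_real_of_nat)
      then show "(\<lambda>m. inverse (real (Suc (\<sigma> m)))) \<longlonglongrightarrow> 0"
        using LIMSEQ_subseq_LIMSEQ[OF _ \<sigma>] by (fastforce simp: comp_def)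
      show "(\<lambda>m. 0::real) \<longlonglongrightarrow> 0" by simp
      show "\<forall>\<^sub>F m in sequentially. 0 \<le> pt (Suc (\<sigma> m)) (r m) i - pt (Suc (\<sigma> m)) (q (\<sigma> m)) i"
        using r by (auto simp: pt_def intro!: always_eventually divide_right_mono)
      have "real (r m i) / real (Suc (\<sigma> m)) - real (q (\<sigma> m) i) / real (Suc (\<sigma> m))
          \<le> inverse (real (Suc (\<sigma> m)))" if "i < n" for m
      proof -
        have "r m i \<le> q (\<sigma> m) i + 1" using r that by blast
        then have "real (r m i) - real (q (\<sigma> m) i) \<le> 1" by linarith
        then show ?thesis
          by (simp add: diff_divide_distrib[symmetric] inverse_eq_divide divide_right_mono
            del: of_nat_Suc)
      qed
      then show "\<forall>\<^sub>F m in sequentially.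
          pt (Suc (\<sigma> m)) (r m) i - pt (Suc (\<sigma> m)) (q (\<sigma> m)) i \<le> inverse (real (Suc (\<sigma> m)))"
        by (auto simp: pt_def intro!: always_eventually)
    qed
    ultimately show "(\<lambda>m. pt (Suc (\<sigma> m)) (r m) i) \<longlonglongrightarrow> x i"
      using tendsto_add by fastforce
  qed
  have "g i x = 0" if i: "i < n" for i
  proof -
    define P where "P m r \<longleftrightarrow> (\<forall>j<n. q (\<sigma> m) j \<le> r j \<and> r j \<le> q (\<sigma> m) j + 1)" for m r
    have "\<forall>m. \<exists>r s. P m r \<and> P m s \<and> 0 \<le> g i (pt (Suc (\<sigma> m)) r) \<and> g i (pt (Suc (\<sigma> m)) s) \<le> 0"
      unfolding P_def using rs[OF i] by simp
    then obtain r s where "\<forall>m. P m (r m) \<and> P m (s m) \<and>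
        0 \<le> g i (pt (Suc (\<sigma> m)) (r m)) \<and> g i (pt (Suc (\<sigma> m)) (s m)) \<le> 0"
      by metis
    then have r: "\<forall>m. \<forall>j<n. q (\<sigma> m) j \<le> r m j \<and> r m j \<le> q (\<sigma> m) j + 1"
      and s: "\<forall>m. \<forall>j<n. q (\<sigma> m) j \<le> s m j \<and> s m j \<le> q (\<sigma> m) j + 1"
      and sgn: "\<forall>m. 0 \<le> g i (pt (Suc (\<sigma> m)) (r m))" "\<forall>m. g i (pt (Suc (\<sigma> m)) (s m)) \<le> 0"
      unfolding P_def by simp_all
    have glim: "(\<lambda>m. g i (pt (Suc (\<sigma> m)) (r m))) \<longlonglongrightarrow> g i x"
      if r: "\<forall>m. \<forall>j<n. q (\<sigma> m) j \<le> r m j \<and> r m j \<le> q (\<sigma> m) j + 1" for r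
    proof (rule continuous_on_tendsto_compose[OF cont[OF i] lim_near[OF r] x])
      have "r m j \<le> Suc (\<sigma> m)" if "j < n" for m j
        using r q[OF that, of "\<sigma> m"] that
        by (metis Suc_eq_plus1 Suc_leI order_trans)
      then show "\<forall>\<^sub>F m in sequentially. pt (Suc (\<sigma> m)) (r m) \<in> K"
        by (auto intro!: always_eventually ptK)
    qed
    have "0 \<le> g i x" by (rule LIMSEQ_le_const[OF glim[OF r]]) (use sgn in auto)
    moreover have "g i x \<le> 0" by (rule LIMSEQ_le_const2[OF glim[OF s]]) (use sgn in auto)
    ultimately show ?thesis by simp
  qed
  with x show ?thesis by (rule that)
qed

section \<open>Covering dimension and continuous images of cubes\<close>

lemma (in Metric_space) lipschitz_continuous_map:
  assumes lip: "\<And>x y. \<lbrakk>x \<in> M; y \<in> M\<rbrakk> \<Longrightarrow> \<bar>f x - f y\<bar> \<le> L * d x y"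
  shows "continuous_map mtopology euclideanreal f"
  unfolding continuous_map_atin
proof
  fix x assume "x \<in> topspace mtopology"
  then have x: "x \<in> M" by simp
  have M: "\<forall>\<^sub>F y in atin mtopology x. y \<in> M"
    using eventually_atin[of "\<lambda>y. y \<in> M" mtopology x] open_in_mspace by auto
  have lim: "((\<lambda>y. d y x) \<longlongrightarrow> 0) (atin mtopology x)"
    using limitin_continuous_map[OF continuous_map_id, of x mtopology] x
    by (simp add: limitin_metric_dist_null id_def)
  have "((\<lambda>y. f y - f x) \<longlongrightarrow> 0) (atin mtopology x)"
  proof (rule Lim_null_comparison)
    show "\<forall>\<^sub>F y in atin mtopology x. norm (f y - f x) \<le> L * d y x"
      using M by eventually_elim (use lip x in auto)
    show "((\<lambda>y. L * d y x) \<longlongrightarrow> 0) (atin mtopology x)"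
      using tendsto_mult_right_zero[OF lim] .
  qed
  then show "limitin euclideanreal f (f x) (atin mtopology x)"
    by (simp add: LIM_zero_iff)
qed

lemma (in Metric_space) closedin_sublevel:
  assumes "\<And>x y. \<lbrakk>x \<in> M; y \<in> M\<rbrakk> \<Longrightarrow> \<bar>f x - f y\<bar> \<le> L * d x y"
  shows "closedin mtopology {x \<in> M. f x \<le> c}"
  using closedin_continuous_map_preimage[OF lipschitz_continuous_map[OF assms], of "{..c}"] by simp

text \<open>The function is the distance to the complement of \<open>W\<close>; as \<open>W\<close>
  is proper, the infimum is over a nonempty set.\<close>

lemma (in Metric_space) ex_support_function:
  assumes "openin mtopology W" "W \<noteq> M"
  obtains f where "continuous_map mtopology euclideanreal f"
    "\<And>x. x \<in> M \<Longrightarrow> 0 \<le> f x" "\<And>x. x \<in> M \<Longrightarrow> 0 < f x \<longleftrightarrow> x \<in> W"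
proof -
  define Z where "Z = M - W"
  have Z: "Z \<noteq> {}" "Z \<subseteq> M"
    using assms openin_subset[OF assms(1)] by (auto simp: Z_def)
  define f where "f x = (INF z\<in>Z. d x z)" for x
  have bdd: "bdd_below (d x ` Z)" for x
    by (rule bdd_belowI2[where m = 0]) simp
  have le: "f x \<le> d x y + f y" if "x \<in> M" "y \<in> M" for x y
  proof -
    have "f x - d x y \<le> d y z" if z: "z \<in> Z" for z
      using cINF_lower[OF bdd z, of x] triangle[of x y z] that \<open>x \<in> M\<close> \<open>y \<in> M\<close> Z
      unfolding f_def by (smt (verit) subsetD)
    then have "f x - d x y \<le> f y"
      unfolding f_def[of y] using Z by (intro cINF_greatest) auto
    then show ?thesis by simp
  qed
  show ?thesis
  proof
    show "continuous_map mtopology euclideanreal f"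
    proof (rule lipschitz_continuous_map[where L = 1])
      fix x y assume "x \<in> M" "y \<in> M"
      then show "\<bar>f x - f y\<bar> \<le> 1 * d x y"
        using le[of x y] le[of y x] commute[of x y] by simp
    qed
    show nonneg: "0 \<le> f x" if "x \<in> M" for x
      unfolding f_def using Z by (intro cINF_greatest) auto
    show "0 < f x \<longleftrightarrow> x \<in> W" if "x \<in> M" for x
    proof
      assume "0 < f x"
      show "x \<in> W"
      proof (rule ccontr)
        assume "x \<notin> W"
        then have "x \<in> Z" using that by (simp add: Z_def)
        then have "f x \<le> d x x" unfolding f_def by (rule cINF_lower[OF bdd])
        then show False using \<open>0 < f x\<close> that by simp
      qed
    next
      assume "x \<in> W"
      then obtain r where r: "r > 0" "mball x r \<subseteq> W"
        using assms(1) unfolding openin_mtopology by blast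
      have "r \<le> d x z" if "z \<in> Z" for z
        using r that Z \<open>x \<in> M\<close> by (force simp: Z_def)
      then have "r \<le> f x" unfolding f_def using Z by (intro cINF_greatest) auto
      with r show "0 < f x" by simp
    qed
  qed
qed

text \<open>
  Lebesgue's argument: the members of a refinement are sorted by the first lower face which they
  meet.  Equating each group's function with the sum of the later ones makes all groups occur at
  one point.
\<close>

lemma (in Metric_space) cube_faces_not_covering_dim_le:
  fixes F :: "(nat \<Rightarrow> real) \<Rightarrow> 'a" and C :: "nat \<Rightarrow> bool \<Rightarrow> 'a set"
  defines "K \<equiv> UNIV \<rightarrow> {0..1}"
  assumes "m < n"
    and F: "continuous_map (top_of_set K) mtopology F"
    and closed: "\<And>i e. i < n \<Longrightarrow> closedin mtopology (C i e)"
    and disj: "\<And>i. i < n \<Longrightarrow> C i False \<inter> C i True = {}"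
    and lower: "\<And>i x. \<lbrakk>i < n; x \<in> K; x i = 0\<rbrakk> \<Longrightarrow> F x \<in> C i False"
    and upper: "\<And>i x. \<lbrakk>i < n; x \<in> K; x i = 1\<rbrakk> \<Longrightarrow> F x \<in> C i True"
  shows "\<not> covering_dim_le mtopology m"
proof
  assume dim: "covering_dim_le mtopology m"
  have FM: "F x \<in> M" if "x \<in> K" for x
    using F that by (auto simp: continuous_map_def)
  \<comment> \<open>One open set for each way of avoiding a member of every pair. Disjointness makes
    them a cover, and a subset of \<open>U e\<close> meets at most one member of each pair.\<close>
  define U where "U e = M - (\<Union>i<n. C i (e i))" for e :: "nat \<Rightarrow> bool"
  have opU: "openin mtopology (U e)" for e
  proof -
    have "closedin mtopology (\<Union>i<n. C i (e i))" using closed by (intro closedin_Union) auto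
    then have "openin mtopology (topspace mtopology - (\<Union>i<n. C i (e i)))"
      by (simp add: closedin_def)
    then show ?thesis by (simp add: U_def)
  qed
  have covU: "\<Union>(range U) = topspace mtopology"
  proof -
    have "x \<in> U (\<lambda>i. x \<notin> C i True)" if "x \<in> M" for x
      using that disj by (auto simp: U_def) (metis (full_types) IntI empty_iff)
    moreover have "U e \<subseteq> M" for e by (auto simp: U_def)
    ultimately show ?thesis by auto
  qed
  obtain \<V> where \<V>: "\<forall>V\<in>\<V>. openin mtopology V" "\<Union>\<V> = topspace mtopology"
      "\<forall>V\<in>\<V>. \<exists>U'\<in>range U. V \<subseteq> U'"
      "\<forall>x\<in>topspace mtopology. finite {V\<in>\<V>. x \<in> V} \<and> card {V\<in>\<V>. x \<in> V} \<le> m + 1"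
  proof -
    have "(\<forall>V\<in>range U. openin mtopology V) \<and> \<Union>(range U) = topspace mtopology"
      using opU covU by (intro conjI ballI) auto
    then show thesis
      using spec[OF dim[unfolded covering_dim_le_def], of "range U"] that
      by (elim impE exE conjE) simp_all
  qed
  have opV: "openin mtopology V" if "V \<in> \<V>" for V
    using \<V>(1) that by blast
  have covV: "\<Union>\<V> = M" using \<V>(2) by simp
  have refV: "\<exists>e. V \<subseteq> U e" if "V \<in> \<V>" for V
    using \<V>(3) that by blast
  have ordV: "finite {V\<in>\<V>. x \<in> V} \<and> card {V\<in>\<V>. x \<in> V} \<le> m + 1" if "x \<in> M" for x
    using \<V>(4) that by simp
  \<comment> \<open>The value \<open>n\<close> is left for sets that meet no
    \<open>C k False\<close>, so there are \<open>n + 1\<close> groups.\<close>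
  define grp where "grp V = (LEAST k. k = n \<or> V \<inter> C k False \<noteq> {})" for V
  have grp_le: "grp V \<le> n" for V
    unfolding grp_def by (rule Least_le) simp
  have grp_eq: "grp V = n \<or> V \<inter> C (grp V) False \<noteq> {}" for V
    unfolding grp_def by (rule LeastI[of _ n]) simp
  have grp_lower: "V \<inter> C k False = {}" if "k < grp V" for k V
    using not_less_Least[of k "\<lambda>k. k = n \<or> V \<inter> C k False \<noteq> {}"] that unfolding grp_def by blast
  have grp_upper: "V \<inter> C (grp V) True = {}" if "grp V < n" "V \<in> \<V>" for V
  proof -
    obtain e where e: "V \<subseteq> U e" using refV \<open>V \<in> \<V>\<close> by blast
    then have "V \<inter> C (grp V) (e (grp V)) = {}" using that(1) by (auto simp: U_def)
    then show ?thesis using grp_eq[of V] that(1) by (cases "e (grp V)") auto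
  qed
  define W where "W k = \<Union>{V\<in>\<V>. grp V = k}" for k
  have opW: "openin mtopology (W k)" for k
    unfolding W_def by (rule openin_Union) (use opV in auto)
  have W_lower: "W k \<inter> C i False = {}" if "i < k" for i k
    using grp_lower that by (fastforce simp: W_def)
  have W_upper: "W k \<inter> C k True = {}" if "k < n" for k
    using grp_upper that by (fastforce simp: W_def)
  have zeroK: "(\<lambda>_. 0) \<in> K" and oneK: "(\<lambda>_. 1) \<in> K" by (auto simp: K_def)
  \<comment> \<open>Two corners witness this: the all-ones corner goes into \<open>C k True\<close>,
    and for \<open>k = n\<close> the all-zeros corner goes into \<open>C 0 False\<close>.\<close>
  have W_ne: "W k \<noteq> M" if "k \<le> n" for k
  proof (cases "k < n")
    case True
    then show ?thesis using W_upper[OF True] upper[OF True oneK] FM[OF oneK] by auto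
  next
    case False
    then have "0 < k" "0 < n" using that \<open>m < n\<close> by auto
    then show ?thesis using W_lower[of 0 k] lower[OF _ zeroK] FM[OF zeroK] by auto
  qed
  have covW: "\<exists>k\<le>n. x \<in> W k" if "x \<in> M" for x
    using that covV grp_le by (fastforce simp: W_def)
  have "\<exists>f. continuous_map mtopology euclideanreal f \<and> (\<forall>x\<in>M. 0 \<le> f x) \<and>
      (\<forall>x\<in>M. 0 < f x \<longleftrightarrow> x \<in> W k)" if "k \<le> n" for k
    by (rule ex_support_function[OF opW W_ne[OF that]]) blast
  then obtain f where f: "\<And>k. k \<le> n \<Longrightarrow> continuous_map mtopology euclideanreal (f k)"
    and f_nonneg: "\<And>k x. \<lbrakk>k \<le> n; x \<in> M\<rbrakk> \<Longrightarrow> 0 \<le> f k x"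
    and f_pos: "\<And>k x. \<lbrakk>k \<le> n; x \<in> M\<rbrakk> \<Longrightarrow> 0 < f k x \<longleftrightarrow> x \<in> W k"
    by metis
  have f_zero: "f k x = 0" if "k \<le> n" "x \<in> M" "x \<notin> W k" for k x
    using f_nonneg[OF that(1,2)] f_pos[OF that(1,2)] that(3) by simp
  have contf: "continuous_on K (\<lambda>x. f k (F x))" if "k \<le> n" for k
    using continuous_map_compose[OF F f[OF that]] by (simp add: comp_def)
  \<comment> \<open>On the face \<open>x i = 0\<close> the sum vanishes because later groups miss
    \<open>C i False\<close>; on \<open>x i = 1\<close> the first term vanishes because group
    \<open>i\<close> misses \<open>C i True\<close>.\<close>
  obtain x where x: "x \<in> K"
    and eq: "\<And>i. i < n \<Longrightarrow> f i (F x) - (\<Sum>k\<in>{i<..n}. f k (F x)) = 0"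
  proof (rule poincare_miranda[of n "\<lambda>i x. f i (F x) - (\<Sum>k\<in>{i<..n}. f k (F x))"])
    fix i assume i: "i < n"
    show "continuous_on (UNIV \<rightarrow> {0..1}) (\<lambda>x. f i (F x) - (\<Sum>k\<in>{i<..n}. f k (F x)))"
      using i contf unfolding K_def by (intro continuous_intros) auto
    fix x :: "nat \<Rightarrow> real" assume "x \<in> UNIV \<rightarrow> {0..1}"
    then have x: "x \<in> K" by (simp add: K_def)
    show "0 \<le> f i (F x) - (\<Sum>k\<in>{i<..n}. f k (F x))" if "x i = 0"
    proof -
      have "F x \<notin> W k" if "k \<in> {i<..n}" for k
        using W_lower[of i k] lower[OF i x \<open>x i = 0\<close>] that by auto
      then have "(\<Sum>k\<in>{i<..n}. f k (F x)) = 0"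
        using f_zero[OF _ FM[OF x]] by (intro sum.neutral) auto
      then show ?thesis using f_nonneg[OF _ FM[OF x], of i] i by simp
    qed
    show "f i (F x) - (\<Sum>k\<in>{i<..n}. f k (F x)) \<le> 0" if "x i = 1"
    proof -
      have "F x \<notin> W i" using W_upper[OF i] upper[OF i x that] by auto
      then have "f i (F x) = 0" using f_zero[OF _ FM[OF x]] i by simp
      moreover have "0 \<le> (\<Sum>k\<in>{i<..n}. f k (F x))"
        using f_nonneg[OF _ FM[OF x]] by (intro sum_nonneg) auto
      ultimately show ?thesis by simp
    qed
  qed (auto simp: K_def)
  define y where "y = F x"
  have y: "y \<in> M" using FM[OF x] by (simp add: y_def)
  have eqy: "f i y = (\<Sum>k\<in>{i<..n}. f k y)" if "i < n" for i
    using eq[OF that] by (simp add: y_def)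
  \<comment> \<open>Read from \<open>n\<close> downwards, the equations would otherwise make every
    \<open>f k y\<close> zero, although some \<open>W k\<close> contains \<open>y\<close>.\<close>
  have pos: "0 < f n y"
  proof (rule ccontr)
    assume "\<not> 0 < f n y"
    then have n0: "f n y = 0" using f_nonneg[OF _ y, of n] by simp
    have "f (n - j) y = 0" for j
    proof (induction j rule: less_induct)
      case (less j)
      show ?case
      proof (cases "j = 0 \<or> n = 0")
        case False
        have "f k y = 0" if "k \<in> {n - j<..n}" for k
          using less[of "n - k"] that by auto
        then show ?thesis using False eqy[of "n - j"] by simp
      qed (use n0 in auto)
    qed
    then have "f k y = 0" if "k \<le> n" for k
      using that by (metis diff_diff_cancel)
    then show False using covW[OF y] f_pos[OF _ y] by force
  qed
  have "0 < f k y" if "k \<le> n" for k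
  proof (cases "k = n")
    case False
    then have "k < n" using that by simp
    have "f n y \<le> (\<Sum>j\<in>{k<..n}. f j y)"
      using f_nonneg[OF _ y] \<open>k < n\<close> by (intro member_le_sum) auto
    then show ?thesis using eqy[OF \<open>k < n\<close>] pos by simp
  qed (use pos in simp)
  then have "\<forall>k\<le>n. y \<in> W k" using f_pos[OF _ y] by simp
  then obtain V where V: "\<And>k. k \<le> n \<Longrightarrow> V k \<in> \<V> \<and> grp (V k) = k \<and> y \<in> V k"
    unfolding W_def by simp metis
  \<comment> \<open>\<open>grp\<close> recovers the index, so the \<open>V k\<close> are
    \<open>n + 1\<close> different members of the refinement at \<open>y\<close>, while at most
    \<open>m + 1\<close> are allowed.\<close>
  have "inj_on V {..n}" using V by (intro inj_on_inverseI[of _ grp]) auto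
  then have "n + 1 = card (V ` {..n})" by (simp add: card_image)
  also have "\<dots> \<le> card {V\<in>\<V>. y \<in> V}"
    using V ordV[OF y] by (intro card_mono) auto
  also have "\<dots> \<le> m + 1" using ordV[OF y] by simp
  finally show False using \<open>m < n\<close> by simp
qed

section \<open>Geometry of CAT(0) spaces\<close>

text \<open>Stewart's theorem. It turns the comparison of a point on a side with the opposite vertex
  into a formula in the distances alone.\<close>

lemma dist_convex_combination:
  fixes p q w :: "'a::real_inner"
  shows "(dist ((1 - t) *\<^sub>R p + t *\<^sub>R q) w)\<^sup>2 =
    (1 - t) * (dist p w)\<^sup>2 + t * (dist q w)\<^sup>2 - t * (1 - t) * (dist p q)\<^sup>2"
proof -
  have "(1 - t) *\<^sub>R p + t *\<^sub>R q - w = (1 - t) *\<^sub>R (p - w) + t *\<^sub>R (q - w)"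
    by (simp add: algebra_simps)
  moreover have "(norm ((1 - t) *\<^sub>R u + t *\<^sub>R v))\<^sup>2 =
      (1 - t) * (norm u)\<^sup>2 + t * (norm v)\<^sup>2 - t * (1 - t) * (norm (u - v))\<^sup>2" for u v :: 'a
    unfolding power2_norm_eq_inner
    by (simp add: inner_simps inner_commute) (simp add: algebra_simps power2_eq_square)
  ultimately show ?thesis
    by (simp add: dist_norm)
qed

lemma comparison_triangle:
  fixes a b c :: real
  assumes "0 \<le> a" "0 \<le> b" "0 \<le> c" "a \<le> b + c" "b \<le> a + c" "c \<le> a + b"
  obtains p q r :: "real^2" where "dist p q = a" "dist q r = b" "dist r p = c"
proof (cases "a = 0")
  case True
  then have "b = c" using assms by simp
  then show ?thesis
    using True \<open>0 \<le> c\<close> that[of 0 0 "vector [c, 0]"]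
    by (simp add: dist_norm norm_vec_def L2_set_def sum_2)
next
  case False
  then have a: "0 < a" using assms by simp
  \<comment> \<open>First coordinate of \<open>r\<close> by the law of cosines, with
    \<open>p\<close> at the origin and \<open>q\<close> at \<open>(a, 0)\<close>. The triangle
    inequalities put \<open>x\<close> between \<open>-c\<close> and \<open>c\<close>, which makes
    the square root below real.\<close>
  define x where "x = (a\<^sup>2 + c\<^sup>2 - b\<^sup>2) / (2 * a)"
  have ax: "2 * a * x = a\<^sup>2 + c\<^sup>2 - b\<^sup>2" using a by (simp add: x_def)
  have "b\<^sup>2 \<le> (a + c)\<^sup>2" by (rule power_mono) (use assms in auto)
  then have "a * (- c) \<le> a * x" using ax by (simp add: power2_eq_square algebra_simps)
  moreover have "\<bar>a - c\<bar>\<^sup>2 \<le> b\<^sup>2" by (rule power_mono) (use assms in auto)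
  then have "a * x \<le> a * c" using ax by (simp add: power2_eq_square algebra_simps)
  ultimately have "\<bar>x\<bar> \<le> c"
    unfolding mult_le_cancel_left_pos[OF a] by simp
  then have xc: "x\<^sup>2 \<le> c\<^sup>2" by (simp add: abs_le_square_iff[symmetric])
  show ?thesis
  proof
    let ?p = "0 :: real^2" and ?q = "vector [a, 0] :: real^2"
      and ?r = "vector [x, sqrt (c\<^sup>2 - x\<^sup>2)] :: real^2"
    show "dist ?p ?q = a"
      using a by (simp add: dist_norm norm_vec_def L2_set_def sum_2)
    have "(a - x)\<^sup>2 + (c\<^sup>2 - x\<^sup>2) = b\<^sup>2" using ax by (simp add: power2_eq_square algebra_simps)
    then show "dist ?q ?r = b"
      using xc \<open>0 \<le> b\<close> by (simp add: dist_norm norm_vec_def L2_set_def sum_2)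
    show "dist ?r ?p = c"
      using xc \<open>0 \<le> c\<close> by (simp add: dist_norm norm_vec_def L2_set_def sum_2)
  qed
qed

context CAT0_space
begin

section \<open>Stewart's inequality and points on geodesics\<close>

lemma geodesic_segmentD:
  assumes "geodesic_segment S x y" "z \<in> S"
  shows "z \<in> M" "d x z + d z y = d x y"
proof -
  obtain c where c: "c ` {0..d x y} = S" "S \<subseteq> M" "c 0 = x" "c (d x y) = y"
    "\<And>s t. \<lbrakk>s \<in> {0..d x y}; t \<in> {0..d x y}\<rbrakk> \<Longrightarrow> d (c s) (c t) = \<bar>s - t\<bar>"
    using assms(1) unfolding geodesic_segment_def by metis
  then show "z \<in> M" using assms(2) by blast
  obtain s where "s \<in> {0..d x y}" "z = c s" using c(1) assms(2) by blast
  then show "d x z + d z y = d x y" using c(5)[of 0 s] c(5)[of s "d x y"] c(3,4) by simp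
qed

lemma geodesic_segment_point:
  assumes "geodesic_segment S x y" "t \<in> {0..1}"
  obtains z where "z \<in> S" "d x z = t * d x y" "d z y = (1 - t) * d x y"
proof -
  obtain c where c: "c ` {0..d x y} = S" "c 0 = x" "c (d x y) = y"
    "\<And>s t. \<lbrakk>s \<in> {0..d x y}; t \<in> {0..d x y}\<rbrakk> \<Longrightarrow> d (c s) (c t) = \<bar>s - t\<bar>"
    using assms(1) unfolding geodesic_segment_def by metis
  have t: "t * d x y \<in> {0..d x y}"
    using assms(2) by (simp add: mult_left_le_one_le)
  show ?thesis
    by (rule that[of "c (t * d x y)"])
      (use c(1) t c(4)[OF _ t, of 0] c(4)[OF t, of "d x y"] c(2,3) in \<open>auto simp: algebra_simps\<close>)
qed

lemma obtain_comparison_triangle: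
  assumes "p \<in> M" "q \<in> M" "r \<in> M"
  obtains p' q' r' :: "real^2"
  where "dist p' q' = d p q" "dist q' r' = d q r" "dist r' p' = d r p"
  using comparison_triangle[of "d p q" "d q r" "d r p"] that
    triangle[of p r q] triangle[of q p r] triangle[of r q p] commute assms
  by (metis add.commute nonneg)

lemma comparison_pairsI:
  assumes "geodesic_segment S p q" "z \<in> S" "d p z = t * d p q" "t \<in> {0..1}" "dist p' q' = d p q"
  shows "(z, (1 - t) *\<^sub>R p' + t *\<^sub>R q') \<in> comparison_pairs S p q p' q'"
proof -
  have 1: "dist p' ((1 - t) *\<^sub>R p' + t *\<^sub>R q') = t * dist p' q'"
  proof -
    have "p' - ((1 - t) *\<^sub>R p' + t *\<^sub>R q') = t *\<^sub>R (p' - q')" by (simp add: algebra_simps)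
    then show ?thesis using assms(4) by (simp add: dist_norm)
  qed
  have 2: "dist ((1 - t) *\<^sub>R p' + t *\<^sub>R q') q' = (1 - t) * dist p' q'"
  proof -
    have "(1 - t) *\<^sub>R p' + t *\<^sub>R q' - q' = (1 - t) *\<^sub>R (p' - q')" by (simp add: algebra_simps)
    then show ?thesis using assms(4) by (simp add: dist_norm)
  qed
  have "d z q = (1 - t) * d p q"
    using geodesic_segmentD(2)[OF assms(1,2)] assms(3) by (simp add: algebra_simps)
  then show ?thesis
    unfolding comparison_pairs_def using assms 1 2 by (auto simp: in_segment)
qed

lemma stewart_segment:
  assumes "geodesic_segment S x y" "z \<in> S" "d x z = t * d x y" "t \<in> {0..1}"
    and M: "x \<in> M" "y \<in> M" "w \<in> M"
  shows "(d z w)\<^sup>2 \<le> (1 - t) * (d x w)\<^sup>2 + t * (d y w)\<^sup>2 - t * (1 - t) * (d x y)\<^sup>2"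
proof -
  obtain T U where T: "geodesic_segment T y w" and U: "geodesic_segment U w x"
    using geodesic M by blast
  obtain x' y' w' :: "real^2" where tri: "dist x' y' = d x y" "dist y' w' = d y w" "dist w' x' = d w x"
    using obtain_comparison_triangle[OF M] .
  \<comment> \<open>Comparison pairs are formed along sides, so the vertex \<open>w\<close> enters
    as the end, with parameter 1, of the side \<open>T\<close> from \<open>y\<close>.\<close>
  obtain w0 where "w0 \<in> T" "d y w0 = 1 * d y w" "d w0 w = (1 - 1) * d y w"
    by (rule geodesic_segment_point[OF T, of 1]) auto
  moreover then have "w0 = w"
    using M geodesic_segmentD(1)[OF T] by simp
  ultimately have "(w, (1 - 1) *\<^sub>R y' + 1 *\<^sub>R w') \<in> comparison_pairs T y w y' w'"
    using tri by (intro comparison_pairsI[OF T]) auto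
  then have "d z w \<le> dist ((1 - t) *\<^sub>R x' + t *\<^sub>R y') w'"
    using comparison_pairsI[OF assms(1-4) tri(1)]
    by (intro CAT0_inequality[OF M assms(1) T U tri]) (auto simp: triangle_comparison_pairs_def)
  then have "(d z w)\<^sup>2 \<le> (dist ((1 - t) *\<^sub>R x' + t *\<^sub>R y') w')\<^sup>2"
    by (intro power_mono) auto
  then show ?thesis
    unfolding dist_convex_combination using tri by (simp add: dist_commute commute)
qed

text \<open>Described by two distances without reference to a segment, so that isometries and
  reversal transport it at once. Between points of \<open>M\<close> and for \<open>t\<close> in
  \<open>{0..1}\<close> it exists and, by Stewart's inequality, is unique.\<close>

definition geodesic_point :: "'a \<Rightarrow> 'a \<Rightarrow> real \<Rightarrow> 'a" where
  "geodesic_point x y t = (SOME z. z \<in> M \<and> d x z = t * d x y \<and> d z y = (1 - t) * d x y)"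

text \<open>For a point with these distances the bound in \<open>stewart_segment\<close> is a
  multiple of \<open>t + (1 - t) - 1\<close>, hence 0, and the point coincides with the one on
  \<open>S\<close>. This places \<open>geodesic_point\<close> on every segment.\<close>

lemma geodesic_point_unique_segment:
  assumes "geodesic_segment S x y" "x \<in> M" "y \<in> M" "t \<in> {0..1}"
    and "w \<in> M" "d x w = t * d x y" "d w y = (1 - t) * d x y"
  shows "w \<in> S"
proof -
  obtain z where z: "z \<in> S" "d x z = t * d x y" "d z y = (1 - t) * d x y"
    using geodesic_segment_point[OF assms(1,4)] .
  have "(d z w)\<^sup>2 \<le> (1 - t) * (d x w)\<^sup>2 + t * (d y w)\<^sup>2 - t * (1 - t) * (d x y)\<^sup>2"
    using stewart_segment[OF assms(1) z(1,2) assms(4,2,3,5)] .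
  also have "\<dots> = 0"
    unfolding commute[of y w] assms(6,7) by (simp add: power2_eq_square algebra_simps)
  finally have "z = w" using geodesic_segmentD(1)[OF assms(1) z(1)] \<open>w \<in> M\<close> by simp
  with z show ?thesis by simp
qed

lemma geodesic_point:
  assumes "x \<in> M" "y \<in> M" "t \<in> {0..1}"
  shows "geodesic_point x y t \<in> M" "d x (geodesic_point x y t) = t * d x y"
    "d (geodesic_point x y t) y = (1 - t) * d x y"
proof -
  obtain S where S: "geodesic_segment S x y" using geodesic assms by blast
  have "\<exists>z. z \<in> M \<and> d x z = t * d x y \<and> d z y = (1 - t) * d x y"
    using geodesic_segment_point[OF S assms(3)] geodesic_segmentD(1)[OF S] by metis
  from someI_ex[OF this] show "geodesic_point x y t \<in> M" "d x (geodesic_point x y t) = t * d x y"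
    "d (geodesic_point x y t) y = (1 - t) * d x y"
    unfolding geodesic_point_def by simp_all
qed

lemma stewart:
  assumes "x \<in> M" "y \<in> M" "w \<in> M" "t \<in> {0..1}"
  shows "(d (geodesic_point x y t) w)\<^sup>2
    \<le> (1 - t) * (d x w)\<^sup>2 + t * (d y w)\<^sup>2 - t * (1 - t) * (d x y)\<^sup>2"
proof -
  obtain S where S: "geodesic_segment S x y" using geodesic assms by blast
  have "geodesic_point x y t \<in> S"
    using geodesic_point_unique_segment[OF S] geodesic_point assms by blast
  then show ?thesis using stewart_segment[OF S] geodesic_point assms by blast
qed

lemma geodesic_point_unique:
  assumes "x \<in> M" "y \<in> M" "t \<in> {0..1}" "w \<in> M" "d x w = t * d x y" "d w y = (1 - t) * d x y"
  shows "w = geodesic_point x y t"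
proof -
  have "(d (geodesic_point x y t) w)\<^sup>2
      \<le> (1 - t) * (d x w)\<^sup>2 + t * (d y w)\<^sup>2 - t * (1 - t) * (d x y)\<^sup>2"
    by (rule stewart) (use assms in auto)
  also have "\<dots> = 0"
    unfolding commute[of y w] assms(5,6) by (simp add: power2_eq_square algebra_simps)
  finally show ?thesis using geodesic_point(1)[OF assms(1-3)] \<open>w \<in> M\<close> by simp
qed

lemma geodesic_point_commute:
  assumes "x \<in> M" "y \<in> M" "t \<in> {0..1}"
  shows "geodesic_point y x (1 - t) = geodesic_point x y t"
  using geodesic_point[of y x "1 - t"] assms
  by (intro geodesic_point_unique) (auto simp: commute)

lemma geodesic_point_0 [simp]: "\<lbrakk>x \<in> M; y \<in> M\<rbrakk> \<Longrightarrow> geodesic_point x y 0 = x"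
  by (rule geodesic_point_unique[symmetric]) auto

lemma geodesic_point_1 [simp]: "\<lbrakk>x \<in> M; y \<in> M\<rbrakk> \<Longrightarrow> geodesic_point x y 1 = y"
  by (rule geodesic_point_unique[symmetric]) auto

lemma geodesic_point_same [simp]: "\<lbrakk>x \<in> M; t \<in> {0..1}\<rbrakk> \<Longrightarrow> geodesic_point x x t = x"
  by (rule geodesic_point_unique[symmetric]) auto

text \<open>In the comparison triangle the two points divide the sides from \<open>x'\<close> in the
  same ratio, so by similarity their distance is exactly \<open>t\<close> times the opposite
  side.\<close>

lemma dist_geodesic_point_right:
  assumes M: "x \<in> M" "y \<in> M" "z \<in> M" and t: "t \<in> {0..1}"
  shows "d (geodesic_point x y t) (geodesic_point x z t) \<le> t * d y z"
proof -
  obtain S T U where S: "geodesic_segment S x y" and T: "geodesic_segment T y z"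
    and U: "geodesic_segment U z x"
    using geodesic[OF M(1,2)] geodesic[OF M(2,3)] geodesic[OF M(3,1)] that by fast
  obtain x' y' z' :: "real^2" where tri: "dist x' y' = d x y" "dist y' z' = d y z" "dist z' x' = d z x"
    using obtain_comparison_triangle[OF M] .
  have "geodesic_point x y t \<in> S"
    using geodesic_point_unique_segment[OF S] geodesic_point M t by blast
  then have 1: "(geodesic_point x y t, (1 - t) *\<^sub>R x' + t *\<^sub>R y') \<in> comparison_pairs S x y x' y'"
    using geodesic_point M t tri by (intro comparison_pairsI[OF S]) auto
  \<comment> \<open>The third side of the triangle runs from \<open>z\<close> to \<open>x\<close>,
    so the point has parameter \<open>1 - t\<close> on it.\<close>
  have z: "d z (geodesic_point x z t) = (1 - t) * d z x" "d (geodesic_point x z t) x = (1 - (1 - t)) * d z x"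
    using geodesic_point[OF M(1,3) t] by (simp_all add: commute)
  have "geodesic_point x z t \<in> U"
    using geodesic_point_unique_segment[OF U M(3,1) _ _ z] geodesic_point(1)[OF M(1,3) t] t by simp
  then have 2: "(geodesic_point x z t, (1 - (1 - t)) *\<^sub>R z' + (1 - t) *\<^sub>R x') \<in> comparison_pairs U z x z' x'"
    using z t tri by (intro comparison_pairsI[OF U]) auto
  have "d (geodesic_point x y t) (geodesic_point x z t)
      \<le> dist ((1 - t) *\<^sub>R x' + t *\<^sub>R y') ((1 - (1 - t)) *\<^sub>R z' + (1 - t) *\<^sub>R x')"
    by (intro CAT0_inequality[OF M S T U tri]) (use 1 2 in \<open>auto simp: triangle_comparison_pairs_def\<close>)
  also have "\<dots> = norm (t *\<^sub>R (y' - z'))"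
    by (simp add: dist_norm algebra_simps)
  also have "\<dots> = t * d y z" using t tri by (simp add: dist_norm)
  finally show ?thesis .
qed

text \<open>Convexity of the metric: the diagonal from \<open>x\<close> to \<open>y'\<close> cuts
  the quadrilateral into two triangles, one with apex \<open>x\<close> and one with apex
  \<open>y'\<close>.\<close>

lemma dist_geodesic_point:
  assumes M: "x \<in> M" "y \<in> M" "x' \<in> M" "y' \<in> M" and t: "t \<in> {0..1}"
  shows "d (geodesic_point x y t) (geodesic_point x' y' t) \<le> (1 - t) * d x x' + t * d y y'"
proof -
  have t': "1 - t \<in> {0..1}" using t by simp
  have "d (geodesic_point x y t) (geodesic_point x' y' t)
      \<le> d (geodesic_point x y t) (geodesic_point x y' t)
        + d (geodesic_point x y' t) (geodesic_point x' y' t)"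
    by (rule triangle) (use geodesic_point(1) assms in auto)
  moreover have "d (geodesic_point x y t) (geodesic_point x y' t) \<le> t * d y y'"
    by (rule dist_geodesic_point_right) fact+
  moreover have "d (geodesic_point x y' t) (geodesic_point x' y' t) \<le> (1 - t) * d x x'"
    using dist_geodesic_point_right[OF M(4,1,3) t'] geodesic_point_commute M t by simp
  ultimately show ?thesis by simp
qed

lemma dist_geodesic_point_parameter:
  assumes M: "x \<in> M" "y \<in> M" and st: "s \<in> {0..1}" "t \<in> {0..1}"
  shows "d (geodesic_point x y s) (geodesic_point x y t) = \<bar>s - t\<bar> * d x y"
proof -
  obtain S where S: "geodesic_segment S x y" using geodesic assms by blast
  then obtain c where c: "c ` {0..d x y} = S" "c 0 = x" "c (d x y) = y" "S \<subseteq> M"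
    "\<And>s t. \<lbrakk>s \<in> {0..d x y}; t \<in> {0..d x y}\<rbrakk> \<Longrightarrow> d (c s) (c t) = \<bar>s - t\<bar>"
    unfolding geodesic_segment_def by metis
  have u: "u * d x y \<in> {0..d x y}" if "u \<in> {0..1}" for u
    using that by (simp add: mult_left_le_one_le)
  have "c (u * d x y) = geodesic_point x y u" if "u \<in> {0..1}" for u
    by (rule geodesic_point_unique)
      (use M that u[OF that] c c(5)[OF _ u[OF that], of 0] c(5)[OF u[OF that], of "d x y"]
        in \<open>auto simp: algebra_simps\<close>)
  then show ?thesis
    using c(5)[OF u u] st by (simp add: left_diff_distrib[symmetric] abs_mult)
qed

section \<open>Isometries, closed convex sets and minimisers\<close>

lemma isometry_of_closed: "isometry_of g \<Longrightarrow> x \<in> M \<Longrightarrow> g x \<in> M"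
  by (auto simp: isometry_of_def bij_betw_def)

lemma isometry_of_dist: "isometry_of g \<Longrightarrow> x \<in> M \<Longrightarrow> y \<in> M \<Longrightarrow> d (g x) (g y) = d x y"
  by (simp add: isometry_of_def)

lemma isometry_geodesic_point:
  assumes "isometry_of g" "x \<in> M" "y \<in> M" "t \<in> {0..1}"
  shows "g (geodesic_point x y t) = geodesic_point (g x) (g y) t"
  using assms geodesic_point[of x y t]
  by (intro geodesic_point_unique) (auto simp: isometry_of_closed isometry_of_dist)

text \<open>Euler's quadrilateral inequality, from the CN inequality at the midpoint of one diagonal.\<close>

lemma quadrilateral_inequality:
  assumes M: "x \<in> M" "y \<in> M" "u \<in> M" "v \<in> M"
  shows "(d x v)\<^sup>2 + (d y u)\<^sup>2 \<le> (d x u)\<^sup>2 + (d y v)\<^sup>2 + (d x y)\<^sup>2 + (d u v)\<^sup>2"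
proof -
  define m where "m = geodesic_point x v (1/2)"
  have m: "m \<in> M" using geodesic_point(1) M by (simp add: m_def)
  have "(d m u)\<^sup>2 \<le> (d x u)\<^sup>2 / 2 + (d u v)\<^sup>2 / 2 - (d x v)\<^sup>2 / 4"
    using stewart[of x v u "1/2"] M unfolding m_def commute[of v u] by simp
  moreover have "(d m y)\<^sup>2 \<le> (d x y)\<^sup>2 / 2 + (d y v)\<^sup>2 / 2 - (d x v)\<^sup>2 / 4"
    using stewart[of x v y "1/2"] M unfolding m_def commute[of v y] by simp
  moreover have "(d y u)\<^sup>2 \<le> (d m y + d m u)\<^sup>2"
    using triangle''[OF M(2) m M(3)] by (intro power_mono) auto
  moreover have "(d m y + d m u)\<^sup>2 \<le> 2 * (d m y)\<^sup>2 + 2 * (d m u)\<^sup>2"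
    using sum_squares_bound[of "d m y" "d m u"] by (simp add: power2_sum)
  ultimately show ?thesis by linarith
qed

definition closed_convex :: "'a set \<Rightarrow> bool" where
  "closed_convex C \<longleftrightarrow> closedin mtopology C \<and>
     (\<forall>x\<in>C. \<forall>y\<in>C. \<forall>t\<in>{0..1}. geodesic_point x y t \<in> C)"

lemma closed_convex_subset: "closed_convex C \<Longrightarrow> C \<subseteq> M"
  using closedin_subset[of mtopology C] by (simp add: closed_convex_def)

lemma closed_convex_space: "closed_convex M"
  by (simp add: closed_convex_def geodesic_point(1))

lemma closed_convex_Int: "closed_convex C \<Longrightarrow> closed_convex D \<Longrightarrow> closed_convex (C \<inter> D)"
  by (auto simp: closed_convex_def)

lemma closed_convex_sublevel:
  assumes "\<And>x y. \<lbrakk>x \<in> M; y \<in> M\<rbrakk> \<Longrightarrow> \<bar>f x - f y\<bar> \<le> L * d x y"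
    and "\<And>x y t. \<lbrakk>x \<in> M; y \<in> M; t \<in> {0..1}\<rbrakk> \<Longrightarrow> f (geodesic_point x y t) \<le> (1 - t) * f x + t * f y"
  shows "closed_convex {x \<in> M. f x \<le> c}"
  unfolding closed_convex_def
proof (intro conjI ballI)
  show "closedin mtopology {x \<in> M. f x \<le> c}" by (rule closedin_sublevel) fact
  fix x y t assume *: "x \<in> {x \<in> M. f x \<le> c}" "y \<in> {x \<in> M. f x \<le> c}" "t \<in> {0..1::real}"
  then have "f (geodesic_point x y t) \<le> (1 - t) * f x + t * f y" using assms(2) by simp
  also have "\<dots> \<le> (1 - t) * c + t * c" using * by (intro add_mono mult_left_mono) auto
  finally show "geodesic_point x y t \<in> {x \<in> M. f x \<le> c}"
    using geodesic_point(1) * by (simp add: algebra_simps)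
qed

text \<open>Takes a set of maps rather than a group, because it is applied to parts of a generating
  set and to unions of commuting families.\<close>

definition fixed_points :: "('a \<Rightarrow> 'a) set \<Rightarrow> 'a set" where
  "fixed_points T = {x \<in> M. \<forall>g\<in>T. g x = x}"

lemma closed_convex_fixed_points:
  assumes "\<And>g. g \<in> T \<Longrightarrow> isometry_of g"
  shows "closed_convex (fixed_points T)"
proof -
  have fix_iff: "g x = x \<longleftrightarrow> d x (g x) \<le> 0" if "g \<in> T" "x \<in> M" for g x
    using mdist_pos_eq[of x "g x"] isometry_of_closed[OF assms] that
    by (metis linorder_not_less mdist_zero order_refl)
  \<comment> \<open>A displacement function is 2-Lipschitz: moving the point by some amount moves
    its image by the same amount.\<close>
  have "closedin mtopology {x \<in> M. d x (g x) \<le> 0}" if "g \<in> T" for g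
  proof (rule closedin_sublevel[where L = 2])
    fix x y assume xy: "x \<in> M" "y \<in> M"
    then have "g x \<in> M" "g y \<in> M" "d (g x) (g y) = d x y"
      using assms that by (auto simp: isometry_of_closed isometry_of_dist)
    then show "\<bar>d x (g x) - d y (g y)\<bar> \<le> 2 * d x y"
      using xy triangle[of x y "g x"] triangle[of y "g y" "g x"] triangle[of y x "g y"]
        triangle[of x "g x" "g y"] commute
      by (smt (verit))
  qed
  moreover have "fixed_points T = M \<inter> (\<Inter>g\<in>T. {x \<in> M. d x (g x) \<le> 0})"
    using fix_iff by (auto simp: fixed_points_def)
  ultimately have "closedin mtopology (fixed_points T)"
    by (cases "T = {}") (auto intro!: closedin_Int closedin_INT)
  moreover have "geodesic_point x y t \<in> fixed_points T"
    if xyt: "x \<in> fixed_points T" "y \<in> fixed_points T" "t \<in> {0..1}" for x y t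
  proof -
    have "g (geodesic_point x y t) = geodesic_point x y t" if g: "g \<in> T" for g
    proof -
      have "g x = x" "g y = y" using xyt g by (simp_all add: fixed_points_def)
      then show ?thesis
        using isometry_geodesic_point[OF assms[OF g], of x y t] xyt by (simp add: fixed_points_def)
    qed
    then show ?thesis using geodesic_point(1) xyt by (simp add: fixed_points_def)
  qed
  ultimately show ?thesis by (simp add: closed_convex_def)
qed

text \<open>A sum of squared distances is uniformly convex: at a midpoint it lies below the mean by
  at least \<open>(d x y)\<^sup>2 / 4\<close>, so minimising sequences are Cauchy. The conclusion
  joins minimality and uniqueness in the form that an isometry permuting \<open>P\<close> can
  exploit.\<close>

lemma closed_convex_minimizer:
  assumes complete: mcomplete and D: "closed_convex D" "D \<noteq> {}"
    and P: "finite P" "P \<noteq> {}" "P \<subseteq> M"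
  defines "\<Phi> \<equiv> \<lambda>x. \<Sum>p\<in>P. (d x p)\<^sup>2"
  shows "\<exists>x\<in>D. \<forall>y\<in>D. \<Phi> y \<le> \<Phi> x \<longrightarrow> y = x"
proof -
  have DM: "x \<in> M" if "x \<in> D" for x using closed_convex_subset[OF D(1)] that by blast
  have nonneg: "0 \<le> \<Phi> x" for x by (simp add: \<Phi>_def sum_nonneg)
  then have bdd: "bdd_below (\<Phi> ` D)" by (intro bdd_belowI2[where m = 0])
  define I where "I = (INF x\<in>D. \<Phi> x)"
  have I_le: "I \<le> \<Phi> x" if "x \<in> D" for x
    unfolding I_def by (rule cINF_lower[OF bdd that])
  have strict: "(d x y)\<^sup>2 \<le> 2 * \<Phi> x + 2 * \<Phi> y - 4 * I" if xy: "x \<in> D" "y \<in> D" for x y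
  proof -
    define m where "m = geodesic_point x y (1/2)"
    have m: "m \<in> D" using D(1) xy by (simp add: m_def closed_convex_def)
    have "\<Phi> m \<le> (\<Sum>p\<in>P. (d x p)\<^sup>2 / 2 + (d y p)\<^sup>2 / 2 - (d x y)\<^sup>2 / 4)"
      unfolding \<Phi>_def m_def
    proof (rule sum_mono)
      fix p assume "p \<in> P"
      then show "(d (geodesic_point x y (1/2)) p)\<^sup>2 \<le> (d x p)\<^sup>2 / 2 + (d y p)\<^sup>2 / 2 - (d x y)\<^sup>2 / 4"
        using stewart[of x y p "1/2"] xy DM P(3) by auto
    qed
    also have "\<dots> = \<Phi> x / 2 + \<Phi> y / 2 - real (card P) * ((d x y)\<^sup>2 / 4)"
      by (simp add: \<Phi>_def sum.distrib sum_subtractf sum_divide_distrib)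
    finally have "I + real (card P) * ((d x y)\<^sup>2 / 4) \<le> \<Phi> x / 2 + \<Phi> y / 2"
      using I_le[OF m] by linarith
    moreover have "1 * ((d x y)\<^sup>2 / 4) \<le> real (card P) * ((d x y)\<^sup>2 / 4)"
      using P by (intro mult_right_mono) (auto simp: Suc_le_eq card_gt_0_iff)
    ultimately have "I + 1 * ((d x y)\<^sup>2 / 4) \<le> \<Phi> x / 2 + \<Phi> y / 2"
      by (meson add_left_mono order_trans)
    then show ?thesis by (simp add: field_simps)
  qed
  define \<delta> where "\<delta> k = inverse (real (Suc k))" for k
  have \<delta>: "0 < \<delta> k" for k by (simp add: \<delta>_def)
  have "\<exists>x\<in>D. \<Phi> x < I + \<delta> k" for k
    using cINF_less_iff[OF D(2) bdd, of "I + \<delta> k"] \<delta>[of k] by (simp add: I_def)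
  then obtain s where s: "\<And>k. s k \<in> D" "\<And>k. \<Phi> (s k) < I + \<delta> k"
    by metis
  have lim0: "(\<lambda>k. \<delta> k) \<longlonglongrightarrow> 0" by (unfold \<delta>_def) (rule LIMSEQ_inverse_real_of_nat)
  have "MCauchy s"
    unfolding MCauchy_def
  proof (intro conjI allI impI)
    show "range s \<subseteq> M" using s(1) DM by auto
    fix \<epsilon> :: real assume "\<epsilon> > 0"
    \<comment> \<open>\<open>strict\<close> bounds the squared distance of two terms by
      \<open>2 * \<delta> j + 2 * \<delta> k\<close>, which a quarter of
      \<open>\<epsilon>\<^sup>2\<close> for each brings below
      \<open>\<epsilon>\<^sup>2\<close>.\<close>
    then have "0 < \<epsilon>\<^sup>2 / 4" by simp
    then obtain N where N: "\<And>k. N \<le> k \<Longrightarrow> \<delta> k < \<epsilon>\<^sup>2 / 4"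
      using order_tendstoD(2)[OF lim0] unfolding eventually_sequentially by blast
    have "d (s j) (s k) < \<epsilon>" if "N \<le> j" "N \<le> k" for j k
    proof -
      have "(d (s j) (s k))\<^sup>2 < \<epsilon>\<^sup>2"
        using strict[OF s(1) s(1), of j k] s(2)[of j] s(2)[of k] N[OF that(1)] N[OF that(2)]
        by linarith
      then show ?thesis using \<open>\<epsilon> > 0\<close> by (simp add: power2_less_imp_less)
    qed
    then show "\<exists>N. \<forall>j k. N \<le> j \<longrightarrow> N \<le> k \<longrightarrow> d (s j) (s k) < \<epsilon>" by blast
  qed
  then obtain l where l: "limitin mtopology s l sequentially"
    using complete unfolding mcomplete_def by blast
  have "l \<in> D"
    using limitin_closedin[OF l] D(1) s(1) by (simp add: closed_convex_def)
  have "(\<lambda>k. d (s k) p) \<longlonglongrightarrow> d l p" if "p \<in> P" for p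
  proof -
    have p: "p \<in> M" using that P(3) by blast
    have "\<bar>d x p - d y p\<bar> \<le> 1 * d x y" if "x \<in> M" "y \<in> M" for x y
      using mdist_reverse_triangle[of x p y] that p by (simp add: commute)
    then have "continuous_map mtopology euclideanreal (\<lambda>x. d x p)"
      by (rule lipschitz_continuous_map)
    from continuous_map_limit[OF this l] show ?thesis by (simp add: comp_def)
  qed
  then have "(\<lambda>k. \<Phi> (s k)) \<longlonglongrightarrow> \<Phi> l"
    unfolding \<Phi>_def by (intro tendsto_sum tendsto_power)
  moreover have "(\<lambda>k. I + \<delta> k) \<longlonglongrightarrow> I"
    using tendsto_add[OF tendsto_const lim0, of I] by simp
  ultimately have "\<Phi> l \<le> I"
    by (rule LIMSEQ_le) (use s(2) less_imp_le in blast)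
  have "y = l" if "y \<in> D" "\<Phi> y \<le> \<Phi> l" for y
  proof -
    have "(d y l)\<^sup>2 \<le> 0" using strict[OF that(1) \<open>l \<in> D\<close>] that(2) \<open>\<Phi> l \<le> I\<close> by linarith
    then show ?thesis using DM that(1) \<open>l \<in> D\<close> by simp
  qed
  with \<open>l \<in> D\<close> show ?thesis by blast
qed

text \<open>
  For a singleton \<^term>\<open>P\<close> the fixed point is the projection of a fixed point to \<^term>\<open>D\<close>, for an
  orbit \<^term>\<open>P\<close> it is the barycentre of the orbit in \<^term>\<open>D\<close>.
\<close>

lemma fixed_point_in_closed_convex:
  assumes complete: mcomplete and D: "closed_convex D" "D \<noteq> {}"
    and P: "finite P" "P \<noteq> {}" "P \<subseteq> M"
    and T: "\<And>g. g \<in> T \<Longrightarrow> isometry_of g" "\<And>g. g \<in> T \<Longrightarrow> g ` P = P" "\<And>g. g \<in> T \<Longrightarrow> g ` D \<subseteq> D"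
  shows "fixed_points T \<inter> D \<noteq> {}"
proof -
  obtain x where x: "x \<in> D" "\<And>y. \<lbrakk>y \<in> D; (\<Sum>p\<in>P. (d y p)\<^sup>2) \<le> (\<Sum>p\<in>P. (d x p)\<^sup>2)\<rbrakk> \<Longrightarrow> y = x"
    using closed_convex_minimizer[OF complete D P] by blast
  have xM: "x \<in> M" using x(1) closed_convex_subset[OF D(1)] by blast
  have "g x = x" if g: "g \<in> T" for g
  proof (rule x(2))
    show "g x \<in> D" using T(3)[OF g] x(1) by blast
    have "inj_on g P"
      using T(1)[OF g] P(3) unfolding isometry_of_def bij_betw_def by (blast intro: inj_on_subset)
    then have "(\<Sum>p\<in>P. (d (g x) p)\<^sup>2) = (\<Sum>p\<in>P. (d (g x) (g p))\<^sup>2)"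
      using sum.reindex[of g P "\<lambda>p. (d (g x) p)\<^sup>2"] T(2)[OF g] by simp
    also have "\<dots> = (\<Sum>p\<in>P. (d x p)\<^sup>2)"
      using isometry_of_dist[OF T(1)[OF g] xM] P(3) by (intro sum.cong) auto
    finally show "(\<Sum>p\<in>P. (d (g x) p)\<^sup>2) \<le> (\<Sum>p\<in>P. (d x p)\<^sup>2)" by simp
  qed
  with x(1) xM show ?thesis by (auto simp: fixed_points_def)
qed

section \<open>Singular cubes built from geodesics\<close>

lemma continuous_map_geodesic_point:
  assumes u: "continuous_map X mtopology u" and v: "continuous_map X mtopology v"
    and t: "continuous_map X euclideanreal t" "\<And>x. x \<in> topspace X \<Longrightarrow> t x \<in> {0..1}"
  shows "continuous_map X mtopology (\<lambda>x. geodesic_point (u x) (v x) (t x))"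
  unfolding continuous_map_atin
proof
  fix x assume x: "x \<in> topspace X"
  have M: "u y \<in> M" "v y \<in> M" if "y \<in> topspace X" for y
    using u v that by (auto simp: continuous_map_def)
  let ?w = "\<lambda>x. geodesic_point (u x) (v x) (t x)"
  have top: "\<forall>\<^sub>F y in atin X x. y \<in> topspace X"
    using eventually_atin[of "\<lambda>y. y \<in> topspace X" X x] by auto
  have ulim: "((\<lambda>y. d (u y) (u x)) \<longlongrightarrow> 0) (atin X x)"
    using limitin_continuous_map[OF u x refl] by (simp add: limitin_metric_dist_null)
  have vlim: "((\<lambda>y. d (v y) (v x)) \<longlongrightarrow> 0) (atin X x)"
    using limitin_continuous_map[OF v x refl] by (simp add: limitin_metric_dist_null)
  have tlim: "(t \<longlongrightarrow> t x) (atin X x)"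
    using limitin_continuous_map[OF t(1) x refl] by simp
  have "((\<lambda>y. d (?w y) (?w x)) \<longlongrightarrow> 0) (atin X x)"
  proof (rule Lim_null_comparison)
    show "\<forall>\<^sub>F y in atin X x. norm (d (?w y) (?w x))
        \<le> (1 - t y) * d (u y) (u x) + t y * d (v y) (v x) + \<bar>t y - t x\<bar> * d (u x) (v x)"
      using top
    proof eventually_elim
      case (elim y)
      \<comment> \<open>The end points move first, at the parameter \<open>t y\<close>; then the
        parameter moves along the geodesic from \<open>u x\<close> to \<open>v x\<close>.\<close>
      have "d (?w y) (?w x) \<le> d (?w y) (geodesic_point (u x) (v x) (t y))
          + d (geodesic_point (u x) (v x) (t y)) (?w x)"
        by (rule triangle) (use M x elim t(2) geodesic_point(1) in auto)
      moreover have "d (?w y) (geodesic_point (u x) (v x) (t y))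
          \<le> (1 - t y) * d (u y) (u x) + t y * d (v y) (v x)"
        by (rule dist_geodesic_point) (use M x elim t(2) in auto)
      moreover have "d (geodesic_point (u x) (v x) (t y)) (?w x) = \<bar>t y - t x\<bar> * d (u x) (v x)"
        by (rule dist_geodesic_point_parameter) (use M x elim t(2) in auto)
      ultimately show ?case by simp
    qed
    have "((\<lambda>y. (1 - t y) * d (u y) (u x) + t y * d (v y) (v x) + \<bar>t y - t x\<bar> * d (u x) (v x))
        \<longlongrightarrow> (1 - t x) * 0 + t x * 0 + \<bar>t x - t x\<bar> * d (u x) (v x)) (atin X x)"
      by (intro tendsto_intros ulim vlim tlim)
    then show "((\<lambda>y. (1 - t y) * d (u y) (u x) + t y * d (v y) (v x) + \<bar>t y - t x\<bar> * d (u x) (v x))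
        \<longlongrightarrow> 0) (atin X x)"
      by simp
  qed
  moreover have "\<forall>\<^sub>F y in atin X x. ?w y \<in> M"
    using top by eventually_elim (use M t(2) geodesic_point(1) in auto)
  ultimately show "limitin mtopology ?w (?w x) (atin X x)"
    using geodesic_point(1) M[OF x] t(2)[OF x] by (simp add: limitin_metric_dist_null)
qed

text \<open>Coordinate \<open>k\<close> joins two cubes of dimension \<open>k\<close> by geodesics.
  Entries of \<open>e\<close> below the current dimension are overwritten on the way down, so
  \<open>e\<close> fixes only the remaining ones.\<close>

primrec geodesic_cube :: "((nat \<Rightarrow> bool) \<Rightarrow> 'a) \<Rightarrow> nat \<Rightarrow> (nat \<Rightarrow> bool) \<Rightarrow> (nat \<Rightarrow> real) \<Rightarrow> 'a" where
  "geodesic_cube v 0 e x = v e"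
| "geodesic_cube v (Suc k) e x =
     geodesic_point (geodesic_cube v k (e(k := False)) x) (geodesic_cube v k (e(k := True)) x) (x k)"

lemma continuous_geodesic_cube:
  assumes "\<And>e. v e \<in> M"
  shows "continuous_map (top_of_set (UNIV \<rightarrow> {0..1})) mtopology (geodesic_cube v k e)"
proof (induction k arbitrary: e)
  case 0
  show ?case using assms by simp
next
  case (Suc k)
  have "continuous_on (UNIV \<rightarrow> {0..1}) (\<lambda>x::nat \<Rightarrow> real. x k)"
    by (rule continuous_on_product_then_coordinatewise) (rule continuous_on_id)
  then show ?case
    unfolding geodesic_cube.simps by (intro continuous_map_geodesic_point Suc.IH) auto
qed

lemma geodesic_cube_closed:
  assumes v: "\<And>e. v e \<in> M" and x: "x \<in> UNIV \<rightarrow> {0..1}"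
  shows "geodesic_cube v k e x \<in> M"
  using continuous_geodesic_cube[of v k e, OF v] x by (auto simp: continuous_map_def)

text \<open>Before stage \<open>i\<close> all vertices in use have \<open>e i = b\<close>, and
  convexity keeps the cube in \<open>C\<close>. At stage \<open>i\<close> the value of
  \<open>x i\<close> selects the end with \<open>e i = b\<close>; later stages join points already
  in \<open>C\<close>.\<close>

lemma geodesic_cube_face:
  assumes v: "\<And>e. v e \<in> M" and C: "closed_convex C" "\<And>e. e i = b \<Longrightarrow> v e \<in> C"
    and x: "x \<in> UNIV \<rightarrow> {0..1}" "x i = of_bool b"
  shows "e i = b \<or> i < k \<Longrightarrow> geodesic_cube v k e x \<in> C"
proof (induction k arbitrary: e)
  case 0
  then show ?case using C(2) by simp
next
  case (Suc k)
  have xk: "x k \<in> {0..1}" using x(1) by auto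
  note M = geodesic_cube_closed[of v, OF v x(1)]
  consider "k = i" | "k \<noteq> i" "e i = b \<or> i < k" using Suc.prems by linarith
  then show ?case
  proof cases
    case 1
    have "geodesic_cube v k (e(k := b)) x \<in> C" by (rule Suc.IH) (use 1 in simp)
    then show ?thesis using 1 x(2) M by (cases b) simp_all
  next
    case 2
    then have "geodesic_cube v k (e(k := c)) x \<in> C" for c by (intro Suc.IH) auto
    then show ?thesis using C(1) xk by (simp add: closed_convex_def)
  qed
qed

text \<open>The common points serve as vertices: those with \<open>e i = b\<close> lie in the convex
  set \<open>C i b\<close>, and so does the face they span.\<close>

lemma convex_pairs_not_covering_dim_le:
  fixes C :: "nat \<Rightarrow> bool \<Rightarrow> 'a set"
  assumes "m < n"
    and C: "\<And>i e. i < n \<Longrightarrow> closed_convex (C i e)"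
    and disj: "\<And>i. i < n \<Longrightarrow> C i False \<inter> C i True = {}"
    and meet: "\<And>e. \<exists>x\<in>M. \<forall>i<n. x \<in> C i (e i)"
  shows "\<not> covering_dim_le mtopology m"
proof -
  obtain v where v: "\<And>e. v e \<in> M" "\<And>e i. i < n \<Longrightarrow> v e \<in> C i (e i)"
    using meet by metis
  show ?thesis
  proof (rule cube_faces_not_covering_dim_le[OF \<open>m < n\<close> continuous_geodesic_cube[of v, OF v(1)]])
    fix i assume i: "i < n"
    show "closedin mtopology (C i e)" for e using C[OF i] by (simp add: closed_convex_def)
    show "C i False \<inter> C i True = {}" using disj[OF i] .
    have vC: "v e \<in> C i b" if "e i = b" for e b
      using v(2)[OF i, of e] that by simp
    fix x :: "nat \<Rightarrow> real" assume x: "x \<in> UNIV \<rightarrow> {0..1}"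
    show "geodesic_cube v n (\<lambda>_. False) x \<in> C i False" if "x i = 0"
      by (rule geodesic_cube_face[of v, OF v(1) C[OF i] _ x, where i = i and b = False])
        (use that i in \<open>auto intro: vC\<close>)
    show "geodesic_cube v n (\<lambda>_. False) x \<in> C i True" if "x i = 1"
      by (rule geodesic_cube_face[of v, OF v(1) C[OF i] _ x, where i = i and b = True])
        (use that i in \<open>auto intro: vC\<close>)
  qed
qed

end

section \<open>Busemann functions of axial isometries\<close>

context CAT0_space
begin

lemma isometry_of_funpow:
  assumes "isometry_of g"
  shows "isometry_of (g ^^ k)"
proof (induction k)
  case 0
  show ?case by (simp add: isometry_of_def bij_betw_def inj_on_def)
next
  case (Suc k)
  then have "bij_betw (g \<circ> g ^^ k) M M"
    using assms unfolding isometry_of_def by (blast intro: bij_betw_trans)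
  moreover have "d ((g ^^ Suc k) x) ((g ^^ Suc k) y) = d x y" if "x \<in> M" "y \<in> M" for x y
    using that Suc assms by (simp add: isometry_of_dist isometry_of_closed)
  ultimately show ?case by (simp add: isometry_of_def comp_def)
qed

text \<open>\<open>g\<close> maps the midpoint of \<open>y\<close> and \<open>g y\<close> to that of
  \<open>g y\<close> and \<open>g (g y)\<close>, and these midpoints are at most half as far apart
  as \<open>y\<close> and \<open>g (g y)\<close>.\<close>

lemma displacement_square:
  assumes g: "isometry_of g" and l: "\<And>y. y \<in> M \<Longrightarrow> l \<le> d y (g y)" and y: "y \<in> M"
  shows "2 * l \<le> d y (g (g y))"
proof -
  have gy: "g y \<in> M" "g (g y) \<in> M" using g y by (simp_all add: isometry_of_closed)
  define m where "m = geodesic_point y (g y) (1/2)"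
  have "m = geodesic_point (g y) y (1/2)"
    using geodesic_point_commute[of y "g y" "1/2"] y gy by (simp add: m_def)
  moreover have "g m = geodesic_point (g y) (g (g y)) (1/2)"
    using isometry_geodesic_point[OF g] y gy by (simp add: m_def)
  ultimately have "d m (g m) \<le> 1/2 * d y (g (g y))"
    using dist_geodesic_point_right[of "g y" y "g (g y)" "1/2"] y gy by simp
  moreover have "l \<le> d m (g m)"
    using geodesic_point(1) y gy by (intro l) (simp add: m_def)
  ultimately show ?thesis by simp
qed

text \<open>A hyperbolic isometry with a point of minimal displacement; the orbit of
  \<open>p\<close> under the powers of \<open>g\<close> represents the axis through
  \<open>p\<close>.\<close>

definition axial :: "('a \<Rightarrow> 'a) \<Rightarrow> 'a \<Rightarrow> bool" where
  "axial g p \<longleftrightarrow> isometry_of g \<and> p \<in> M \<and> 0 < d p (g p) \<and> (\<forall>y\<in>M. d p (g p) \<le> d y (g y))"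

lemma semisimple_cases:
  assumes "semisimple_isometry g"
  obtains x where "x \<in> M" "g x = x" | p where "axial g p"
proof -
  obtain p where p: "p \<in> M" "d p (g p) = (INF y\<in>M. d y (g y))" and g: "isometry_of g"
    using assms by (auto simp: semisimple_isometry_def)
  have "d p (g p) \<le> d y (g y)" if "y \<in> M" for y
    unfolding p(2) using that by (intro cINF_lower bdd_belowI2[where m = 0]) auto
  moreover have "g p \<in> M" using g p(1) by (rule isometry_of_closed)
  ultimately show thesis
    using that p(1) g unfolding axial_def by (metis mdist_pos_eq)
qed

text \<open>Repeated squaring gives the lower bound at exponents \<open>2 ^ k\<close>. It descends
  to \<open>k\<close> by the triangle inequality, as the missing \<open>2 ^ k - k\<close> steps
  contribute at most one translation length each.\<close>

lemma axial_dist_funpow: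
  assumes "axial g p"
  shows "d p ((g ^^ k) p) = real k * d p (g p)"
proof -
  define l where "l = d p (g p)"
  have g: "isometry_of g" and p: "p \<in> M" and l: "\<And>y. y \<in> M \<Longrightarrow> l \<le> d y (g y)"
    using assms by (auto simp: axial_def l_def)
  have gM: "(g ^^ k) x \<in> M" if "x \<in> M" for k x
    using isometry_of_closed[OF isometry_of_funpow[OF g] that] .
  have upper: "d p ((g ^^ k) p) \<le> real k * l" for k
  proof (induction k)
    case (Suc k)
    have "d p ((g ^^ Suc k) p) \<le> d p (g p) + d (g p) (g ((g ^^ k) p))"
      using triangle[OF p gM[OF p, of 1] gM[OF p, of "Suc k"]] by simp
    also have "\<dots> = l + d p ((g ^^ k) p)"
      using isometry_of_dist[OF g p gM[OF p]] by (simp add: l_def)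
    finally show ?case using Suc by (simp add: algebra_simps)
  qed (simp add: p)
  have lower: "y \<in> M \<Longrightarrow> 2 ^ k * l \<le> d y ((g ^^ (2 ^ k)) y)" for k y
  proof (induction k arbitrary: y)
    case (Suc k)
    have "2 * (2 ^ k * l) \<le> d y ((g ^^ (2 ^ k)) ((g ^^ (2 ^ k)) y))"
      by (rule displacement_square) (use isometry_of_funpow[OF g] Suc in auto)
    also have "(g ^^ (2 ^ k)) ((g ^^ (2 ^ k)) y) = (g ^^ (2 ^ Suc k)) y"
      by (simp add: mult_2 funpow_add)
    finally show ?case by simp
  qed (simp add: l)
  have k: "k \<le> 2 ^ k" using less_exp[of k] by (rule less_imp_le)
  have "2 ^ k * l \<le> d p ((g ^^ (2 ^ k)) p)" using lower[OF p] .
  also have "\<dots> \<le> d p ((g ^^ k) p) + d ((g ^^ k) p) ((g ^^ (2 ^ k)) p)"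
    by (rule triangle) (use p gM in auto)
  also have "(g ^^ (2 ^ k)) p = (g ^^ k) ((g ^^ (2 ^ k - k)) p)"
    using k by (simp flip: funpow_add comp_apply[of "g ^^ k"])
  also have "d ((g ^^ k) p) ((g ^^ k) ((g ^^ (2 ^ k - k)) p)) = d p ((g ^^ (2 ^ k - k)) p)"
    using isometry_of_dist[OF isometry_of_funpow[OF g] p gM[OF p]] .
  also have "\<dots> \<le> real (2 ^ k - k) * l" by (rule upper)
  finally have "real k * l \<le> d p ((g ^^ k) p)"
    using k by (simp add: of_nat_diff algebra_simps)
  with upper[of k] show ?thesis by (simp add: l_def)
qed

text \<open>The Busemann function of the forward end of the axis, normalised to vanish at
  \<open>p\<close>: by \<open>axial_dist_funpow\<close> the subtracted term is the distance from
  \<open>p\<close> to the orbit point.\<close>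

definition busemann :: "('a \<Rightarrow> 'a) \<Rightarrow> 'a \<Rightarrow> 'a \<Rightarrow> real" where
  "busemann g p x = lim (\<lambda>k. d x ((g ^^ k) p) - real k * d p (g p))"

context
  fixes g p
  assumes axial: "axial g p"
begin

lemma axial_isometry: "isometry_of g" and axial_point: "p \<in> M"
  using axial by (simp_all add: axial_def)

lemma axial_orbit_closed: "(g ^^ k) p \<in> M"
  using isometry_of_closed[OF isometry_of_funpow[OF axial_isometry] axial_point] .

text \<open>The sequence decreases, as a step along the orbit adds at most one translation length,
  and is bounded below by \<open>- d x p\<close>.\<close>

lemma busemann_LIMSEQ:
  assumes x: "x \<in> M"
  shows "(\<lambda>k. d x ((g ^^ k) p) - real k * d p (g p)) \<longlonglongrightarrow> busemann g p x"
proof -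
  define s where "s k = d x ((g ^^ k) p) - real k * d p (g p)" for k
  have "decseq s"
  proof (rule decseq_SucI)
    fix k
    have "d x ((g ^^ Suc k) p) \<le> d x ((g ^^ k) p) + d ((g ^^ k) p) ((g ^^ k) (g p))"
      using triangle[OF x axial_orbit_closed axial_orbit_closed, of "Suc k" k]
      by (simp add: funpow_swap1)
    also have "d ((g ^^ k) p) ((g ^^ k) (g p)) = d p (g p)"
      using isometry_of_dist[OF isometry_of_funpow[OF axial_isometry] axial_point]
        axial_orbit_closed[of 1] by simp
    finally show "s (Suc k) \<le> s k" by (simp add: s_def algebra_simps)
  qed
  moreover have "- d x p \<le> s k" for k
    using triangle[OF axial_point x axial_orbit_closed, of k] axial_dist_funpow[OF axial, of k]
    by (simp add: s_def commute)
  ultimately have "convergent s"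
    using decseq_convergent[of s "- d x p"] by (metis convergentI)
  then show ?thesis
    unfolding busemann_def s_def by (rule convergent_LIMSEQ_iff[THEN iffD1])
qed

lemma busemann_lipschitz:
  assumes "x \<in> M" "y \<in> M"
  shows "\<bar>busemann g p x - busemann g p y\<bar> \<le> 1 * d x y"
proof (rule LIMSEQ_le_const2)
  show "(\<lambda>k. \<bar>(d x ((g ^^ k) p) - real k * d p (g p)) - (d y ((g ^^ k) p) - real k * d p (g p))\<bar>)
      \<longlonglongrightarrow> \<bar>busemann g p x - busemann g p y\<bar>"
    by (intro tendsto_intros busemann_LIMSEQ assms)
  show "\<exists>N. \<forall>k\<ge>N. \<bar>(d x ((g ^^ k) p) - real k * d p (g p)) - (d y ((g ^^ k) p) - real k * d p (g p))\<bar>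
      \<le> 1 * d x y"
    using mdist_reverse_triangle[OF assms(1) axial_orbit_closed assms(2)] by (simp add: commute)
qed

lemma busemann_convex:
  assumes M: "x \<in> M" "y \<in> M" and t: "t \<in> {0..1}"
  shows "busemann g p (geodesic_point x y t) \<le> (1 - t) * busemann g p x + t * busemann g p y"
proof (rule LIMSEQ_le[OF busemann_LIMSEQ])
  show "geodesic_point x y t \<in> M" by (rule geodesic_point(1)) fact+
  show "(\<lambda>k. (1 - t) * (d x ((g ^^ k) p) - real k * d p (g p))
      + t * (d y ((g ^^ k) p) - real k * d p (g p)))
      \<longlonglongrightarrow> (1 - t) * busemann g p x + t * busemann g p y"
    by (intro tendsto_intros busemann_LIMSEQ M)
  have "d (geodesic_point x y t) z \<le> (1 - t) * d x z + t * d y z" if "z \<in> M" for z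
    using dist_geodesic_point[OF M that that t] that t by simp
  from this[OF axial_orbit_closed]
  show "\<exists>N. \<forall>k\<ge>N. d (geodesic_point x y t) ((g ^^ k) p) - real k * d p (g p)
      \<le> (1 - t) * (d x ((g ^^ k) p) - real k * d p (g p))
        + t * (d y ((g ^^ k) p) - real k * d p (g p))"
    by (simp add: algebra_simps)
qed

text \<open>An index shift: \<open>g x\<close> is as far from orbit point \<open>Suc k\<close> as
  \<open>x\<close> is from orbit point \<open>k\<close>, but one more translation length is
  subtracted.\<close>

lemma busemann_translate:
  assumes x: "x \<in> M"
  shows "busemann g p (g x) = busemann g p x - d p (g p)"
proof (rule LIMSEQ_unique)
  have gx: "g x \<in> M" using axial_isometry x by (rule isometry_of_closed)
  show "(\<lambda>k. d (g x) ((g ^^ Suc k) p) - real (Suc k) * d p (g p)) \<longlonglongrightarrow> busemann g p (g x)"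
    using LIMSEQ_Suc[OF busemann_LIMSEQ[OF gx]] by simp
  have "(\<lambda>k. (d x ((g ^^ k) p) - real k * d p (g p)) - d p (g p)) \<longlonglongrightarrow> busemann g p x - d p (g p)"
    by (intro tendsto_intros busemann_LIMSEQ x)
  then show "(\<lambda>k. d (g x) ((g ^^ Suc k) p) - real (Suc k) * d p (g p))
      \<longlonglongrightarrow> busemann g p x - d p (g p)"
    using isometry_of_dist[OF axial_isometry x axial_orbit_closed] by (simp add: algebra_simps)
qed

lemma busemann_funpow:
  assumes x: "x \<in> M"
  shows "busemann g p ((g ^^ k) x) = busemann g p x - real k * d p (g p)"
proof (induction k)
  case (Suc k)
  have "(g ^^ k) x \<in> M" using isometry_of_closed[OF isometry_of_funpow[OF axial_isometry] x] .
  then show ?case using busemann_translate[of "(g ^^ k) x"] Suc by (simp add: algebra_simps)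
qed simp

text \<open>
  The two axes stay at bounded distance, so the quadrilateral inequality bounds a difference of
  squares which grows linearly unless the constants agree.
\<close>

lemma busemann_basepoint:
  assumes q: "axial g q" and "x \<in> M" "y \<in> M"
  shows "busemann g q x - busemann g p x = busemann g q y - busemann g p y"
proof -
  define l where "l = d p (g p)"
  have l: "0 < l" "d q (g q) = l"
    using axial q unfolding axial_def l_def by (auto intro: antisym)
  have le: "busemann g q u - busemann g p u \<le> busemann g q v - busemann g p v"
    if M: "u \<in> M" "v \<in> M" for u v
  proof -
    define D where "D = (d u v)\<^sup>2 + (d p q)\<^sup>2"
    let ?P = "\<lambda>k. (g ^^ k) p" and ?Q = "\<lambda>k. (g ^^ k) q"
    have PQ: "?P k \<in> M" "?Q k \<in> M" for k
      using isometry_of_closed[OF isometry_of_funpow[OF axial_isometry]] axial q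
      by (auto simp: axial_def)
    have DPQ: "d (?P k) (?Q k) = d p q" for k
      using isometry_of_dist[OF isometry_of_funpow[OF axial_isometry]] axial q
      by (auto simp: axial_def)
    define a b a' b' where "a k = d u (?Q k) - real k * l" and "b k = d u (?P k) - real k * l"
      and "a' k = d v (?Q k) - real k * l" and "b' k = d v (?P k) - real k * l" for k
    have lim: "a \<longlonglongrightarrow> busemann g q u" "b \<longlonglongrightarrow> busemann g p u"
      "a' \<longlonglongrightarrow> busemann g q v" "b' \<longlonglongrightarrow> busemann g p v"
      using CAT0_space.busemann_LIMSEQ[OF CAT0_space_axioms q] busemann_LIMSEQ M l
      unfolding a_def b_def a'_def b'_def l_def by simp_all
    \<comment> \<open>Each distance is \<open>k * l\<close> plus a convergent term. In the
      quadrilateral inequality the squares of \<open>k * l\<close> cancel, and the part linear in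
      \<open>k\<close> carries the combination to be estimated.\<close>
    have bound: "2 * l * (a k - b k - a' k + b' k)
        \<le> (D - ((a k)\<^sup>2 + (b' k)\<^sup>2 - (b k)\<^sup>2 - (a' k)\<^sup>2)) * inverse (real k)" if "0 < k" for k
    proof -
      have "(d u (?Q k))\<^sup>2 + (d v (?P k))\<^sup>2 \<le> (d u (?P k))\<^sup>2 + (d v (?Q k))\<^sup>2 + D"
        using quadrilateral_inequality[OF M PQ, of k k] by (simp add: D_def DPQ)
      moreover have "d u (?Q k) = a k + real k * l" "d u (?P k) = b k + real k * l"
        "d v (?Q k) = a' k + real k * l" "d v (?P k) = b' k + real k * l"
        by (simp_all add: a_def b_def a'_def b'_def)
      ultimately have "2 * l * (a k - b k - a' k + b' k) * real k
          \<le> D - ((a k)\<^sup>2 + (b' k)\<^sup>2 - (b k)\<^sup>2 - (a' k)\<^sup>2)"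
        by (simp add: power2_sum algebra_simps)
      then show ?thesis using that by (simp add: field_simps)
    qed
    have "2 * l * (busemann g q u - busemann g p u - busemann g q v + busemann g p v)
        \<le> (D - ((busemann g q u)\<^sup>2 + (busemann g p v)\<^sup>2 - (busemann g p u)\<^sup>2 - (busemann g q v)\<^sup>2)) * 0"
    proof (rule LIMSEQ_le)
      show "(\<lambda>k. 2 * l * (a k - b k - a' k + b' k))
          \<longlonglongrightarrow> 2 * l * (busemann g q u - busemann g p u - busemann g q v + busemann g p v)"
        by (intro tendsto_intros lim)
      show "(\<lambda>k. (D - ((a k)\<^sup>2 + (b' k)\<^sup>2 - (b k)\<^sup>2 - (a' k)\<^sup>2)) * inverse (real k))
          \<longlonglongrightarrow> (D - ((busemann g q u)\<^sup>2 + (busemann g p v)\<^sup>2 - (busemann g p u)\<^sup>2 - (busemann g q v)\<^sup>2)) * 0"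
        by (intro tendsto_intros lim lim_inverse_n)
      show "\<exists>N. \<forall>k\<ge>N. 2 * l * (a k - b k - a' k + b' k)
          \<le> (D - ((a k)\<^sup>2 + (b' k)\<^sup>2 - (b k)\<^sup>2 - (a' k)\<^sup>2)) * inverse (real k)"
        using bound by (intro exI[of _ 1]) auto
    qed
    then show ?thesis using l(1) by (simp add: mult_le_0_iff)
  qed
  from le[OF assms(2,3)] le[OF assms(3,2)] show ?thesis by simp
qed

text \<open>\<open>h\<close> carries the orbit of \<open>p\<close> to that of \<open>h p\<close>, so
  it turns the Busemann function based at \<open>p\<close> into the one based at \<open>h p\<close>;
  by \<open>busemann_basepoint\<close> the two differ by a constant.\<close>

lemma busemann_commuting:
  assumes h: "isometry_of h" and comm: "\<And>x. x \<in> M \<Longrightarrow> g (h x) = h (g x)"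
    and M: "x \<in> M" "y \<in> M"
  shows "busemann g p (h x) - busemann g p x = busemann g p (h y) - busemann g p y"
proof -
  have pow: "(g ^^ k) (h z) = h ((g ^^ k) z)" if "z \<in> M" for k z
    using that comm isometry_of_closed[OF isometry_of_funpow[OF axial_isometry]]
    by (induction k) auto
  have hM: "h z \<in> M" if "z \<in> M" for z using isometry_of_closed[OF h that] .
  have gp: "g p \<in> M" using axial_orbit_closed[of 1] by simp
  have dh: "d (h p) (g (h p)) = d p (g p)"
    using comm[OF axial_point] isometry_of_dist[OF h axial_point gp] by simp
  then have hp: "axial g (h p)" using axial hM by (simp add: axial_def)
  have eq: "busemann g (h p) (h z) = busemann g p z" if z: "z \<in> M" for z
    unfolding busemann_def dh
    using pow[OF axial_point] isometry_of_dist[OF h z axial_orbit_closed] by simp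
  show ?thesis
    using busemann_basepoint[OF hp hM[OF M(1)] hM[OF M(2)]] eq M by simp
qed

end

text \<open>The \<open>k\<close>-th forward and backward orbit points are \<open>2 * k\<close>
  translation lengths apart, and a detour through \<open>x\<close> is no shorter. This is what
  separates opposite horoballs.\<close>

lemma busemann_inverse_nonneg:
  assumes g: "axial g p" and h: "axial h p" and inv: "\<And>x. x \<in> M \<Longrightarrow> g (h x) = x" and x: "x \<in> M"
  shows "0 \<le> busemann g p x + busemann h p x"
proof (rule LIMSEQ_le_const)
  have M: "p \<in> M" "h p \<in> M" "g p \<in> M"
    using g h by (auto simp: axial_def isometry_of_closed)
  have dh: "d p (h p) = d p (g p)"
    using isometry_of_dist[of g "h p" p] inv[OF M(1)] M g by (simp add: axial_def commute)
  show "(\<lambda>k. (d x ((g ^^ k) p) - real k * d p (g p)) + (d x ((h ^^ k) p) - real k * d p (h p)))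
      \<longlonglongrightarrow> busemann g p x + busemann h p x"
    by (intro tendsto_add busemann_LIMSEQ g h x)
  have "2 * (real k * d p (g p)) \<le> d x ((g ^^ k) p) + d x ((h ^^ k) p)" for k
  proof -
    have iso: "isometry_of (g ^^ k)" using g by (simp add: axial_def isometry_of_funpow)
    have gk: "(g ^^ k) p \<in> M" and hk: "(h ^^ j) p \<in> M" for j
      using axial_orbit_closed g h by auto
    have "(g ^^ k) ((h ^^ k) p) = p"
    proof (induction k)
      case (Suc k)
      have "(g ^^ Suc k) ((h ^^ Suc k) p) = (g ^^ k) (g (h ((h ^^ k) p)))"
        by (simp add: funpow_swap1)
      then show ?case using inv hk Suc axial_orbit_closed[OF h] by simp
    qed simp
    then have "d ((h ^^ k) p) ((g ^^ k) p) = d p ((g ^^ k) ((g ^^ k) p))"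
      using isometry_of_dist[OF iso hk[of k] gk] by simp
    also have "\<dots> = d p ((g ^^ (k + k)) p)" by (simp add: funpow_add)
    also have "\<dots> = 2 * (real k * d p (g p))" by (simp add: axial_dist_funpow[OF g])
    finally show ?thesis
      using triangle[OF hk[of k] x gk] by (simp add: commute)
  qed
  then show "\<exists>N. \<forall>k\<ge>N. 0 \<le> (d x ((g ^^ k) p) - real k * d p (g p))
      + (d x ((h ^^ k) p) - real k * d p (h p))"
    by (simp add: dh algebra_simps)
qed

end

section \<open>Commuting actions\<close>

text \<open>A homomorphism to the reals is constant on cosets of the derived subgroup, so here it
  has finitely many values; a largest absolute value that can be doubled is 0.\<close>

lemma (in group) real_hom_vanishes:
  fixes f :: "'a \<Rightarrow> real"
  assumes fin: "finite (carrier (abelianisation G))"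
    and f: "\<And>x y. \<lbrakk>x \<in> carrier G; y \<in> carrier G\<rbrakk> \<Longrightarrow> f (x \<otimes> y) = f x + f y"
    and x: "x \<in> carrier G"
  shows "f x = 0"
proof -
  define K where "K = derived G (carrier G)"
  have f_one: "f \<one> = 0" using f[of \<one> \<one>] by simp
  have f_inv: "f (inv y) = - f y" if "y \<in> carrier G" for y
    using f[of y "inv y"] that f_one by simp
  have "subgroup {y \<in> carrier G. f y = 0} G"
    by (rule subgroupI) (use f f_one f_inv in auto)
  moreover have "derived_set G (carrier G) \<subseteq> {y \<in> carrier G. f y = 0}"
    using f f_inv by auto
  ultimately have K: "K \<subseteq> {y \<in> carrier G. f y = 0}"
    unfolding K_def derived_def by (intro generate_subgroup_incl)
  have one: "\<one> \<in> K" unfolding K_def derived_def by (rule generate.one)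
  have "f ` (K #> y) = {f y}" if y: "y \<in> carrier G" for y
  proof -
    have "f (h \<otimes> y) = f y" if "h \<in> K" for h using f[of h y] K that y by auto
    then show ?thesis using one unfolding r_coset_def by (force simp: image_iff)
  qed
  \<comment> \<open>\<open>the_elem\<close> reads off the one value of \<open>f\<close> on a coset,
    so the values of \<open>f\<close> are indexed by the finitely many cosets.\<close>
  then have "f y \<in> (\<lambda>c. the_elem (f ` c)) ` (rcosets K)" if "y \<in> carrier G" for y
    using that by (intro image_eqI[where x = "K #> y"]) (auto simp: RCOSETS_def)
  then have "f ` carrier G \<subseteq> (\<lambda>c. the_elem (f ` c)) ` (rcosets K)"
    by blast
  moreover have "finite (rcosets K)"
    using fin by (simp add: abelianisation_def FactGroup_def K_def)
  ultimately have fin: "finite (f ` carrier G)"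
    by (meson finite_imageI finite_subset)
  have bound: "\<bar>f y\<bar> \<le> Max ((\<lambda>z. \<bar>f z\<bar>) ` carrier G)" if "y \<in> carrier G" for y
    using that finite_imageI[OF fin, of abs] by (intro Max_ge) (auto simp: image_image)
  have "Max ((\<lambda>z. \<bar>f z\<bar>) ` carrier G) \<in> (\<lambda>z. \<bar>f z\<bar>) ` carrier G"
    using x finite_imageI[OF fin, of abs] by (intro Max_in) (auto simp: image_image)
  then obtain y where y: "y \<in> carrier G" "Max ((\<lambda>z. \<bar>f z\<bar>) ` carrier G) = \<bar>f y\<bar>" by auto
  have "\<bar>f y\<bar> \<le> 0" using bound[of "y \<otimes> y"] y f[of y y] by simp
  then show ?thesis using bound[OF x] y(2) by simp
qed

context CAT0_space
begin

section \<open>Separating pairs and intersections of invariant sets\<close>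

lemma fixed_pointsD: "x \<in> fixed_points T \<Longrightarrow> g \<in> T \<Longrightarrow> g x = x"
  by (simp add: fixed_points_def)

lemma fixed_points_generate:
  assumes "group_action A M \<psi>" "S \<subseteq> carrier A" "generate A S = carrier A"
  shows "fixed_points (\<psi> ` S) = fixed_points (\<psi> ` carrier A)"
proof
  interpret group_action A M \<psi> by fact
  interpret group A using group_hom group_hom.axioms(1) by auto
  show "fixed_points (\<psi> ` S) \<subseteq> fixed_points (\<psi> ` carrier A)"
  proof
    fix x assume x: "x \<in> fixed_points (\<psi> ` S)"
    then have "S \<subseteq> stabilizer A \<psi> x" "subgroup (stabilizer A \<psi> x) A"
      using assms(2) stabilizer_subgroup by (auto simp: fixed_points_def stabilizer_def)
    then have "carrier A \<subseteq> stabilizer A \<psi> x"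
      using generate_subgroup_incl assms(3) by metis
    then show "x \<in> fixed_points (\<psi> ` carrier A)"
      using x by (auto simp: fixed_points_def stabilizer_def)
  qed
  show "fixed_points (\<psi> ` carrier A) \<subseteq> fixed_points (\<psi> ` S)"
    using assms(2) by (auto simp: fixed_points_def)
qed

lemma fixed_points_meet_invariant:
  assumes complete: mcomplete
    and T: "\<And>g. g \<in> T \<Longrightarrow> isometry_of g" "fixed_points T \<noteq> {}"
    and D: "closed_convex D" "D \<noteq> {}" "\<And>g. g \<in> T \<Longrightarrow> g ` D \<subseteq> D"
  shows "fixed_points T \<inter> D \<noteq> {}"
proof -
  obtain p where p: "p \<in> M" "\<And>g. g \<in> T \<Longrightarrow> g p = p" using T(2) by (auto simp: fixed_points_def)
  show ?thesis
    by (rule fixed_point_in_closed_convex[OF complete D(1,2), of "{p}"]) (use p T(1) D(3) in auto)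
qed

lemma fixed_points_invariant:
  assumes "\<And>x. x \<in> M \<Longrightarrow> h x \<in> M" and "\<And>g x. \<lbrakk>g \<in> T; x \<in> M\<rbrakk> \<Longrightarrow> g (h x) = h (g x)"
  shows "h ` fixed_points T \<subseteq> fixed_points T"
proof (intro image_subsetI)
  fix x assume x: "x \<in> fixed_points T"
  then have "g (h x) = h x" if "g \<in> T" for g
    using assms(2)[OF that, of x] fixed_pointsD[OF x that] x by (simp add: fixed_points_def)
  then show "h x \<in> fixed_points T" using assms(1) x by (simp add: fixed_points_def)
qed

lemma axial_inverse:
  assumes "axial g p" "isometry_of h" and inv: "\<And>x. x \<in> M \<Longrightarrow> g (h x) = x"
  shows "axial h p"
proof -
  have "d x (h x) = d (g x) x" if "x \<in> M" for x
    using isometry_of_dist[of g x "h x"] inv[OF that] that assms(1,2)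
    by (simp add: axial_def isometry_of_closed)
  then show ?thesis using assms(1,2) by (simp add: axial_def commute)
qed

text \<open>
  The two sets are the fixed point sets of two complementary parts of a minimal set of generators
  without common fixed point if every element is elliptic, and opposite horoballs of an axis
  otherwise.
\<close>

lemma ex_separating_pair:
  fixes A :: "('g, 'm) monoid_scheme"
  assumes complete: mcomplete
    and act: "group_action A M \<psi>"
    and ss: "\<And>a. a \<in> carrier A \<Longrightarrow> semisimple_isometry (\<psi> a)"
    and gen: "finite S" "S \<subseteq> carrier A" "generate A S = carrier A"
    and fin: "finite (carrier (abelianisation A))"
    and no_fix: "fixed_points (\<psi> ` carrier A) = {}"
  shows "\<exists>C. (\<forall>e. closed_convex (C e)) \<and> C False \<inter> C True = {} \<and>
    (\<forall>e D. closed_convex D \<longrightarrow> D \<noteq> {} \<longrightarrow> (\<forall>a\<in>carrier A. \<psi> a ` D \<subseteq> D) \<longrightarrow> C e \<inter> D \<noteq> {}) \<and>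
    (\<forall>e \<theta>. group_action A M \<theta> \<longrightarrow> (\<forall>h\<in>carrier A. isometry_of (\<theta> h)) \<longrightarrow>
      (\<forall>a\<in>carrier A. \<forall>h\<in>carrier A. \<forall>x\<in>M. \<psi> a (\<theta> h x) = \<theta> h (\<psi> a x)) \<longrightarrow>
      (\<forall>h\<in>carrier A. \<theta> h ` C e \<subseteq> C e))"
    (is "\<exists>C. ?convex C \<and> ?disjoint C \<and> ?meets C \<and> ?invariant C")
proof -
  interpret group_action A M \<psi> by fact
  interpret A: group A using group_hom group_hom.axioms(1) by auto
  have iso: "isometry_of (\<psi> a)" if "a \<in> carrier A" for a
    using ss[OF that] by (simp add: semisimple_isometry_def)
  show ?thesis
  proof (cases "\<exists>a\<in>carrier A. \<exists>p. axial (\<psi> a) p")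
    case False
    have elliptic: "fixed_points {\<psi> a} \<noteq> {}" if a: "a \<in> carrier A" for a
    proof -
      obtain x where "x \<in> M" "\<psi> a x = x"
        using semisimple_cases[OF ss[OF a]] False a by metis
      then show ?thesis by (auto simp: fixed_points_def)
    qed
    have no_fix_S: "fixed_points (\<psi> ` S) = {}"
      using fixed_points_generate[OF act gen(2,3)] no_fix by simp
    \<comment> \<open>Smallest in cardinality, so that leaving out any one generator produces fixed
      points.\<close>
    define F where "F = arg_min card (\<lambda>F. F \<subseteq> S \<and> fixed_points (\<psi> ` F) = {})"
    have "(F \<subseteq> S \<and> fixed_points (\<psi> ` F) = {}) \<and>
        (\<forall>F'. F' \<subseteq> S \<and> fixed_points (\<psi> ` F') = {} \<longrightarrow> card F \<le> card F')"
      unfolding F_def by (rule arg_min_nat_lemma[where k = S]) (simp add: no_fix_S)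
    then have F: "F \<subseteq> S" "fixed_points (\<psi> ` F) = {}"
      and min: "\<And>F'. \<lbrakk>F' \<subseteq> S; fixed_points (\<psi> ` F') = {}\<rbrakk> \<Longrightarrow> card F \<le> card F'"
      by simp_all
    have "F \<noteq> {}" using F(2) nonempty by (auto simp: fixed_points_def)
    then obtain s where s: "s \<in> F" by blast
    \<comment> \<open>The single generator has fixed points because it is elliptic, the rest by
      minimality; a point fixed by both parts would be fixed by all of \<open>F\<close>.\<close>
    define T where "T e = \<psi> ` (if e then F - {s} else {s})" for e
    define C where "C e = fixed_points (T e)" for e
    have TA: "\<exists>a\<in>carrier A. g = \<psi> a" if "g \<in> T e" for g e
      using that F(1) gen(2) s by (auto simp: T_def split: if_splits)
    have C_ne: "fixed_points (T e) \<noteq> {}" for e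
    proof (cases e)
      case True
      have "card (F - {s}) < card F"
        using s F(1) gen(1) by (meson card_Diff1_less finite_subset)
      then show ?thesis using min[of "F - {s}"] F(1) True by (auto simp: T_def)
    next
      case False
      then show ?thesis using elliptic[of s] s F(1) gen(2) by (auto simp: T_def)
    qed
    have Tiso: "isometry_of g" if "g \<in> T e" for g e
      using TA[OF that] iso by blast
    have "?convex C"
      unfolding C_def by (intro allI closed_convex_fixed_points Tiso)
    moreover have "?disjoint C"
    proof -
      have "C False \<inter> C True = fixed_points (\<psi> ` F)"
        using s by (auto simp: C_def T_def fixed_points_def)
      then show ?thesis using F(2) by simp
    qed
    moreover have "?meets C"
    proof (intro allI impI)
      fix e D assume D: "closed_convex D" "D \<noteq> {}" "\<forall>a\<in>carrier A. \<psi> a ` D \<subseteq> D"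
      have "g ` D \<subseteq> D" if "g \<in> T e" for g
        using TA[OF that] D(3) by blast
      then show "C e \<inter> D \<noteq> {}"
        unfolding C_def by (intro fixed_points_meet_invariant complete Tiso C_ne D(1,2))
    qed
    moreover have "?invariant C"
    proof (intro allI impI ballI)
      fix e \<theta> h
      assume \<theta>: "\<forall>h\<in>carrier A. isometry_of (\<theta> h)" and h: "h \<in> carrier A"
        and comm: "\<forall>a\<in>carrier A. \<forall>h\<in>carrier A. \<forall>x\<in>M. \<psi> a (\<theta> h x) = \<theta> h (\<psi> a x)"
      have "g (\<theta> h x) = \<theta> h (g x)" if "g \<in> T e" "x \<in> M" for g x
        using TA[OF that(1)] comm h that(2) by blast
      then show "\<theta> h ` C e \<subseteq> C e"
        unfolding C_def using \<theta> h isometry_of_closed by (intro fixed_points_invariant) auto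
    qed
    ultimately show ?thesis by blast
  next
    case True
    then obtain a p where a: "a \<in> carrier A" and p: "axial (\<psi> a) p" by blast
    define c where "c e = (if e then inv\<^bsub>A\<^esub> a else a)" for e
    have c: "c e \<in> carrier A" for e using a by (simp add: c_def)
    have inverse: "\<psi> a (\<psi> (inv\<^bsub>A\<^esub> a) x) = x" if "x \<in> M" for x
      using composition_rule[OF that a A.inv_closed[OF a]] id_eq_one that a
      by (metis A.r_inv restrict_apply')
    have p': "axial (\<psi> (inv\<^bsub>A\<^esub> a)) p"
      by (rule axial_inverse[OF p]) (use a iso inverse in auto)
    have ax: "axial (\<psi> (c e)) p" for e using p p' by (simp add: c_def)
    have pM: "p \<in> M" using p by (simp add: axial_def)
    define b where "b e = busemann (\<psi> (c e)) p" for e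
    \<comment> \<open>Any negative level would do: by \<open>busemann_inverse_nonneg\<close> the two
      functions are never negative at the same point.\<close>
    define C where "C e = {x \<in> M. b e x \<le> -1}" for e
    have "?convex C"
      unfolding C_def b_def
      using closed_convex_sublevel busemann_lipschitz[OF ax] busemann_convex[OF ax] by blast
    moreover have "?disjoint C"
    proof -
      have "0 \<le> b False x + b True x" if "x \<in> M" for x
        using busemann_inverse_nonneg[OF p p' inverse that] by (simp add: b_def c_def)
      then show ?thesis by (force simp: C_def)
    qed
    moreover have "?meets C"
    proof (intro allI impI)
      fix e D assume D: "closed_convex D" "D \<noteq> {}" "\<forall>a\<in>carrier A. \<psi> a ` D \<subseteq> D"
      then obtain x where x: "x \<in> D" "x \<in> M" using closed_convex_subset by blast
      \<comment> \<open>Powers of \<open>c e\<close> keep the point in \<open>D\<close> and lower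
        \<open>b e\<close> by the translation length each time, so the level -1 is passed.\<close>
      have xk: "(\<psi> (c e) ^^ k) x \<in> D" for k
        by (induction k) (use x D(3) c in auto)
      define l where "l = d p (\<psi> (c e) p)"
      have "0 < l" using ax by (simp add: l_def axial_def)
      then obtain k where "b e x + 1 < real k * l" using reals_Archimedean3 by blast
      then have "b e ((\<psi> (c e) ^^ k) x) \<le> -1"
        using busemann_funpow[OF ax x(2), of e k] by (simp add: b_def l_def)
      then show "C e \<inter> D \<noteq> {}"
        using xk[of k] closed_convex_subset[OF D(1)] by (auto simp: C_def)
    qed
    moreover have "?invariant C"
    proof (intro allI impI ballI)
      fix e \<theta> h
      assume "group_action A M \<theta>" and \<theta>: "\<forall>h\<in>carrier A. isometry_of (\<theta> h)" and h: "h \<in> carrier A"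
        and comm: "\<forall>a\<in>carrier A. \<forall>h\<in>carrier A. \<forall>x\<in>M. \<psi> a (\<theta> h x) = \<theta> h (\<psi> a x)"
      interpret \<theta>: group_action A M \<theta> by fact
      have \<theta>M: "\<theta> u x \<in> M" if "u \<in> carrier A" "x \<in> M" for u x
        using that \<theta> isometry_of_closed by blast
      have const: "b e (\<theta> u x) - b e x = b e (\<theta> u p) - b e p" if "u \<in> carrier A" "x \<in> M" for u x
        unfolding b_def by (rule busemann_commuting[OF ax]) (use \<theta> comm c that pM in auto)
      \<comment> \<open>By \<open>const\<close> this change of \<open>b e\<close> is the same at
        every point, which makes it additive along the action \<open>\<theta>\<close> and hence a
        homomorphism on \<open>A\<close>.\<close>
      define f where "f u = b e (\<theta> u p) - b e p" for u
      have "f h = 0"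
      proof (rule A.real_hom_vanishes[OF fin _ h])
        fix u v assume uv: "u \<in> carrier A" "v \<in> carrier A"
        have "f (u \<otimes>\<^bsub>A\<^esub> v) = b e (\<theta> u (\<theta> v p)) - b e p"
          unfolding f_def using \<theta>.composition_rule[OF pM uv] by simp
        also have "\<dots> = f u + f v"
          using const[OF uv(1) \<theta>M[OF uv(2) pM]] by (simp add: f_def)
        finally show "f (u \<otimes>\<^bsub>A\<^esub> v) = f u + f v" .
      qed
      then have "b e (\<theta> h x) = b e x" if "x \<in> M" for x
        using const[OF h that] by (simp add: f_def)
      then show "\<theta> h ` C e \<subseteq> C e" using \<theta>M[OF h] by (auto simp: C_def)
    qed
    ultimately show ?thesis by blast
  qed
qed

text \<open>The sets are intersected one at a time: \<open>T k\<close> preserves each of the first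
  \<open>k\<close>, hence their intersection, and \<open>meet\<close> finds a point of it in
  \<open>C k\<close>. Serves both separating pairs and fixed point sets.\<close>

lemma invariant_closed_convex_meet:
  fixes n :: nat
  assumes C: "\<And>i. i < n \<Longrightarrow> closed_convex (C i)"
    and inv: "\<And>i j g. \<lbrakk>i < n; j < n; i \<noteq> j; g \<in> T j\<rbrakk> \<Longrightarrow> g ` C i \<subseteq> C i"
    and TM: "\<And>i g. \<lbrakk>i < n; g \<in> T i\<rbrakk> \<Longrightarrow> g ` M \<subseteq> M"
    and meet: "\<And>i D. \<lbrakk>i < n; closed_convex D; D \<noteq> {}; \<forall>g\<in>T i. g ` D \<subseteq> D\<rbrakk> \<Longrightarrow> C i \<inter> D \<noteq> {}"
  shows "\<exists>x\<in>M. \<forall>i<n. x \<in> C i"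
proof -
  define D where "D k = {x \<in> M. \<forall>i<k. x \<in> C i}" for k
  have "k \<le> n \<Longrightarrow> closed_convex (D k) \<and> D k \<noteq> {}" for k
  proof (induction k)
    case 0
    show ?case using closed_convex_space nonempty by (simp add: D_def)
  next
    case (Suc k)
    then have k: "k < n" and IH: "closed_convex (D k)" "D k \<noteq> {}" by auto
    have eq: "D (Suc k) = C k \<inter> D k" by (auto simp: D_def less_Suc_eq)
    have "g ` D k \<subseteq> D k" if g: "g \<in> T k" for g
    proof
      fix y assume "y \<in> g ` D k"
      then obtain x where x: "x \<in> D k" "y = g x" by blast
      have "y \<in> M" using TM[OF k g] x by (auto simp: D_def)
      moreover have "y \<in> C i" if "i < k" for i
        using inv[OF _ k _ g, of i] that k x by (auto simp: D_def)
      ultimately show "y \<in> D k" by (simp add: D_def)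
    qed
    then have "C k \<inter> D k \<noteq> {}" using meet[OF k IH] by blast
    then show ?case using closed_convex_Int[OF C[OF k] IH(1)] eq by simp
  qed
  from this[of n] show ?thesis by (auto simp: D_def)
qed

text \<open>Commutation makes each fixed point set invariant under the other families; projecting a
  fixed point makes it meet the sets preserved by its own.\<close>

lemma commuting_fixed_points:
  fixes n :: nat
  assumes complete: mcomplete
    and iso: "\<And>i g. \<lbrakk>i < n; g \<in> T i\<rbrakk> \<Longrightarrow> isometry_of g"
    and comm: "\<And>i j g h x. \<lbrakk>i < n; j < n; i \<noteq> j; g \<in> T i; h \<in> T j; x \<in> M\<rbrakk> \<Longrightarrow> g (h x) = h (g x)"
    and fix_ne: "\<And>i. i < n \<Longrightarrow> fixed_points (T i) \<noteq> {}"
  shows "fixed_points (\<Union>i<n. T i) \<noteq> {}"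
proof -
  have "\<exists>x\<in>M. \<forall>i<n. x \<in> fixed_points (T i)"
  proof (rule invariant_closed_convex_meet)
    show "closed_convex (fixed_points (T i))" if "i < n" for i
      by (rule closed_convex_fixed_points) (rule iso[OF that])
    show "g ` fixed_points (T i) \<subseteq> fixed_points (T i)" if "i < n" "j < n" "i \<noteq> j" "g \<in> T j" for i j g
      using that comm isometry_of_closed[OF iso] by (intro fixed_points_invariant) auto
    show "g ` M \<subseteq> M" if "i < n" "g \<in> T i" for i g
      using isometry_of_closed[OF iso[OF that]] by blast
    show "fixed_points (T i) \<inter> D \<noteq> {}"
      if "i < n" "closed_convex D" "D \<noteq> {}" "\<forall>g\<in>T i. g ` D \<subseteq> D" for i D
      using that iso fix_ne by (intro fixed_points_meet_invariant complete) auto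
  qed
  then show ?thesis by (auto simp: fixed_points_def)
qed

theorem commuting_actions_fixed_point:
  fixes A :: "('g, 'm) monoid_scheme" and \<psi> :: "nat \<Rightarrow> 'g \<Rightarrow> 'a \<Rightarrow> 'a"
  assumes complete: mcomplete and dim: "covering_dim_le mtopology m" "m < n"
    and A: "finitely_generated_group A" "finite (carrier (abelianisation A))"
    and act: "\<And>i. i < n \<Longrightarrow> group_action A M (\<psi> i)"
    and ss: "\<And>i a. \<lbrakk>i < n; a \<in> carrier A\<rbrakk> \<Longrightarrow> semisimple_isometry (\<psi> i a)"
    and comm: "\<And>i j a b x. \<lbrakk>i < n; j < n; i \<noteq> j; a \<in> carrier A; b \<in> carrier A; x \<in> M\<rbrakk>
      \<Longrightarrow> \<psi> i a (\<psi> j b x) = \<psi> j b (\<psi> i a x)"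
  shows "\<exists>i<n. fixed_points (\<psi> i ` carrier A) \<noteq> {}"
proof (rule ccontr)
  assume "\<not> ?thesis"
  then have no_fix: "fixed_points (\<psi> i ` carrier A) = {}" if "i < n" for i using that by blast
  obtain S where S: "finite S" "S \<subseteq> carrier A" "generate A S = carrier A"
    using A(1) by (auto simp: finitely_generated_group_def)
  have iso: "isometry_of (\<psi> i a)" if "i < n" "a \<in> carrier A" for i a
    using ss[OF that] by (simp add: semisimple_isometry_def)
  note pair = ex_separating_pair[OF complete act ss S A(2) no_fix]
  obtain C where C: "\<And>i e. i < n \<Longrightarrow> closed_convex (C i e)"
    and disj: "\<And>i. i < n \<Longrightarrow> C i False \<inter> C i True = {}"
    and meets: "\<And>i e D. \<lbrakk>i < n; closed_convex D; D \<noteq> {}; \<forall>a\<in>carrier A. \<psi> i a ` D \<subseteq> D\<rbrakk>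
      \<Longrightarrow> C i e \<inter> D \<noteq> {}"
    and invariant: "\<And>i e \<theta> h. \<lbrakk>i < n; group_action A M \<theta>; \<forall>h\<in>carrier A. isometry_of (\<theta> h);
      \<forall>a\<in>carrier A. \<forall>h\<in>carrier A. \<forall>x\<in>M. \<psi> i a (\<theta> h x) = \<theta> h (\<psi> i a x); h \<in> carrier A\<rbrakk>
      \<Longrightarrow> \<theta> h ` C i e \<subseteq> C i e"
  proof -
    define good where "good i C \<longleftrightarrow> (\<forall>e. closed_convex (C e)) \<and> C False \<inter> C True = {} \<and>
      (\<forall>e D. closed_convex D \<longrightarrow> D \<noteq> {} \<longrightarrow> (\<forall>a\<in>carrier A. \<psi> i a ` D \<subseteq> D) \<longrightarrow> C e \<inter> D \<noteq> {}) \<and>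
      (\<forall>e \<theta>. group_action A M \<theta> \<longrightarrow> (\<forall>h\<in>carrier A. isometry_of (\<theta> h)) \<longrightarrow>
        (\<forall>a\<in>carrier A. \<forall>h\<in>carrier A. \<forall>x\<in>M. \<psi> i a (\<theta> h x) = \<theta> h (\<psi> i a x)) \<longrightarrow>
        (\<forall>h\<in>carrier A. \<theta> h ` C e \<subseteq> C e))" for i and C :: "bool \<Rightarrow> 'a set"
    have "\<forall>i\<in>{..<n}. \<exists>C. good i C"
      unfolding good_def by (intro ballI pair) auto
    then obtain C where "\<forall>i\<in>{..<n}. good i (C i)" by (rule bchoice[THEN exE])
    then show thesis by (intro that[of C]) (auto simp: good_def)
  qed
  \<comment> \<open>The pattern \<open>e\<close> selects one set per copy; \<open>C i (e i)\<close>
    is preserved by another copy \<open>j\<close> because \<open>invariant\<close> applies to the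
    action \<open>\<psi> j\<close>.\<close>
  have "\<exists>x\<in>M. \<forall>i<n. x \<in> C i (e i)" for e
  proof (rule invariant_closed_convex_meet[where T = "\<lambda>i. \<psi> i ` carrier A"])
    show "closed_convex (C i (e i))" if "i < n" for i by (rule C[OF that])
    show "g ` C i (e i) \<subseteq> C i (e i)"
      if "i < n" "j < n" "i \<noteq> j" "g \<in> \<psi> j ` carrier A" for i j g
      using that invariant[OF that(1) act[OF that(2)]] iso[OF that(2)] comm[OF that(1,2,3)] by auto
    show "g ` M \<subseteq> M" if "i < n" "g \<in> \<psi> i ` carrier A" for i g
      using that isometry_of_closed[OF iso] by auto
    show "C i (e i) \<inter> D \<noteq> {}"
      if "i < n" "closed_convex D" "D \<noteq> {}" "\<forall>g\<in>\<psi> i ` carrier A. g ` D \<subseteq> D" for i D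
      using that by (intro meets) auto
  qed
  then have "\<not> covering_dim_le mtopology m"
    by (intro convex_pairs_not_covering_dim_le[OF dim(2) C disj])
  with dim(1) show False by simp
qed

end

section \<open>Wreath products\<close>

context
  fixes A :: "('a, 'm) monoid_scheme" and B :: "('b, 'n) monoid_scheme"
  assumes A: "group A" and B: "group B" and fin: "finite (carrier B)"
begin

interpretation A: group A by (rule A)
interpretation B: group B by (rule B)

lemma carrier_wreath_product: "carrier (wreath_product A B) = (carrier B \<rightarrow>\<^sub>E carrier A) \<times> carrier B"
  using fin by (auto simp: wreath_product_def semidirect_product_def carrier_sum_group)

lemma mult_wreath_product:
  "(f, b) \<otimes>\<^bsub>wreath_product A B\<^esub> (g, c) =
    (\<lambda>x\<in>carrier B. f x \<otimes>\<^bsub>A\<^esub> wreath_shift B b g x, b \<otimes>\<^bsub>B\<^esub> c)"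
  by (simp add: wreath_product_def semidirect_product_def)

lemma wreath_summand_closed:
  "a \<in> carrier A \<Longrightarrow> wreath_summand A B b a \<in> carrier B \<rightarrow>\<^sub>E carrier A"
  by (auto simp: wreath_summand_def)

lemma wreath_shift_one:
  assumes "f \<in> carrier B \<rightarrow>\<^sub>E carrier A"
  shows "wreath_shift B \<one>\<^bsub>B\<^esub> f = f"
proof
  fix x
  show "wreath_shift B \<one>\<^bsub>B\<^esub> f x = f x"
    using assms PiE_arb[of f "carrier B"] unfolding wreath_shift_def
    by (cases "x \<in> carrier B") simp_all
qed

definition base_embedding :: "'b \<Rightarrow> 'a \<Rightarrow> ('b \<Rightarrow> 'a) \<times> 'b" where
  "base_embedding b a = (wreath_summand A B b a, \<one>\<^bsub>B\<^esub>)"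

definition top_embedding :: "'b \<Rightarrow> ('b \<Rightarrow> 'a) \<times> 'b" where
  "top_embedding b = (\<lambda>x\<in>carrier B. \<one>\<^bsub>A\<^esub>, b)"

lemma base_embedding_hom: "base_embedding b \<in> hom A (wreath_product A B)"
proof (rule homI)
  fix a assume "a \<in> carrier A"
  then show "base_embedding b a \<in> carrier (wreath_product A B)"
    unfolding carrier_wreath_product base_embedding_def using wreath_summand_closed by simp
next
  fix a a' assume a: "a \<in> carrier A" "a' \<in> carrier A"
  show "base_embedding b (a \<otimes>\<^bsub>A\<^esub> a')
      = base_embedding b a \<otimes>\<^bsub>wreath_product A B\<^esub> base_embedding b a'"
    unfolding base_embedding_def mult_wreath_product wreath_shift_one[OF wreath_summand_closed[OF a(2)]]
    using a by (auto simp: wreath_summand_def)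
qed

lemma base_embedding_commute:
  assumes "b \<noteq> b'" "a \<in> carrier A" "a' \<in> carrier A"
  shows "base_embedding b a \<otimes>\<^bsub>wreath_product A B\<^esub> base_embedding b' a'
    = base_embedding b' a' \<otimes>\<^bsub>wreath_product A B\<^esub> base_embedding b a"
  unfolding base_embedding_def mult_wreath_product
    wreath_shift_one[OF wreath_summand_closed[OF assms(2)]]
    wreath_shift_one[OF wreath_summand_closed[OF assms(3)]]
  using assms by (auto simp: wreath_summand_def)

lemma top_embedding_hom: "top_embedding \<in> hom B (wreath_product A B)"
proof (rule homI)
  fix b assume "b \<in> carrier B"
  then show "top_embedding b \<in> carrier (wreath_product A B)"
    unfolding carrier_wreath_product top_embedding_def by auto
next
  fix b b' assume "b \<in> carrier B" "b' \<in> carrier B"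
  then show "top_embedding (b \<otimes>\<^bsub>B\<^esub> b') = top_embedding b \<otimes>\<^bsub>wreath_product A B\<^esub> top_embedding b'"
    unfolding top_embedding_def mult_wreath_product by (auto simp: wreath_shift_def)
qed

text \<open>Conjugation by \<open>b\<close> in a form free of inverses. It transports fixed points
  between copies and makes the common fixed point set of the copies invariant under
  \<open>B\<close>.\<close>

lemma top_base_embedding:
  assumes b: "b \<in> carrier B" "b' \<in> carrier B" and a: "a \<in> carrier A"
  shows "top_embedding b \<otimes>\<^bsub>wreath_product A B\<^esub> base_embedding b' a
    = base_embedding (b \<otimes>\<^bsub>B\<^esub> b') a \<otimes>\<^bsub>wreath_product A B\<^esub> top_embedding b"
  unfolding base_embedding_def top_embedding_def mult_wreath_product
    wreath_shift_summand[OF B b]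
  using b a by (auto simp: wreath_summand_def wreath_shift_def)

text \<open>The copies of \<open>A\<close> together with \<open>B\<close> generate even as a monoid,
  since a function on the finite set \<open>carrier B\<close> is the product of its
  coordinates.\<close>

lemma wreath_product_induct:
  assumes g: "g \<in> carrier (wreath_product A B)"
    and base: "\<And>b a. \<lbrakk>b \<in> carrier B; a \<in> carrier A\<rbrakk> \<Longrightarrow> P (base_embedding b a)"
    and top: "\<And>b. b \<in> carrier B \<Longrightarrow> P (top_embedding b)"
    and mult: "\<And>x y. \<lbrakk>x \<in> carrier (wreath_product A B); y \<in> carrier (wreath_product A B); P x; P y\<rbrakk>
      \<Longrightarrow> P (x \<otimes>\<^bsub>wreath_product A B\<^esub> y)"
  shows "P g"
proof -
  obtain f c where gfc: "g = (f, c)" and f: "f \<in> carrier B \<rightarrow>\<^sub>E carrier A" and c: "c \<in> carrier B"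
    using g unfolding carrier_wreath_product by auto
  have fA: "f x \<in> carrier A" if "x \<in> carrier B" for x using f that by auto
  \<comment> \<open>\<open>f\<close> truncated to \<open>S\<close>; adding \<open>b\<close> to
    \<open>S\<close> is left multiplication by \<open>f b\<close> placed in the copy at
    \<open>b\<close>.\<close>
  define r where "r S = (\<lambda>x\<in>carrier B. if x \<in> S then f x else \<one>\<^bsub>A\<^esub>)" for S
  have r: "r S \<in> carrier B \<rightarrow>\<^sub>E carrier A" for S using fA by (auto simp: r_def)
  have "P (r S, \<one>\<^bsub>B\<^esub>)" if "finite S" "S \<subseteq> carrier B" for S
    using that
  proof (induction S rule: finite_induct)
    case empty
    have "r {} = (\<lambda>x\<in>carrier B. \<one>\<^bsub>A\<^esub>)" unfolding r_def by (rule restrict_ext) simp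
    then show ?case using top[OF B.one_closed] unfolding top_embedding_def by (simp only:)
  next
    case (insert b S)
    have eq: "(r (insert b S), \<one>\<^bsub>B\<^esub>) = base_embedding b (f b) \<otimes>\<^bsub>wreath_product A B\<^esub> (r S, \<one>\<^bsub>B\<^esub>)"
      unfolding base_embedding_def mult_wreath_product wreath_shift_one[OF r]
      using insert fA by (auto simp: r_def wreath_summand_def)
    show ?case unfolding eq
    proof (rule mult)
      show "base_embedding b (f b) \<in> carrier (wreath_product A B)"
        using hom_in_carrier[OF base_embedding_hom] insert fA by simp
      show "(r S, \<one>\<^bsub>B\<^esub>) \<in> carrier (wreath_product A B)"
        using r by (simp add: carrier_wreath_product)
    qed (use insert base fA in auto)
  qed
  from this[of "carrier B"] have "P (r (carrier B), \<one>\<^bsub>B\<^esub>)" using fin by simp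
  moreover have "r (carrier B) = f"
    using f by (auto simp: r_def PiE_iff extensional_def)
  ultimately have Pf: "P (f, \<one>\<^bsub>B\<^esub>)" by simp
  have "g = (f, \<one>\<^bsub>B\<^esub>) \<otimes>\<^bsub>wreath_product A B\<^esub> top_embedding c"
    unfolding gfc top_embedding_def mult_wreath_product
    using f c fA by (auto simp: wreath_shift_def PiE_iff extensional_def)
  moreover have "P \<dots>"
    by (rule mult) (use f c Pf top hom_in_carrier[OF top_embedding_hom] carrier_wreath_product in auto)
  ultimately show ?thesis by simp
qed

end

section \<open>Actions of the wreath product\<close>

lemma group_action_compose_hom:
  assumes "group_action G E \<phi>" "group H" "h \<in> hom H G"
  shows "group_action H E (\<lambda>x. \<phi> (h x))"
proof -
  interpret group_action G E \<phi> by fact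
  have "group_hom G (BijGroup E) \<phi>" by (rule group_hom)
  then have "\<phi> \<circ> h \<in> hom H (BijGroup E)"
    using assms(3) hom_compose group_hom.homh by blast
  then show ?thesis
    using assms(2) group_BijGroup
    by (simp add: group_action_def group_hom_def group_hom_axioms_def comp_def)
qed

theorem theorem2:
  fixes A :: "('a, 'm) monoid_scheme" and B :: "('b, 'n) monoid_scheme"
  assumes "finitely_generated_group A"
    and "finite (carrier (abelianisation A))"
    and "group B"
    and "finite (carrier B)"
  shows "property_Fix TYPE('x) (card (carrier B) - 1) (wreath_product A B)"
  unfolding property_Fix_def
proof (intro allI impI, elim conjE)
  fix M :: "'x set" and d \<phi>
  assume CAT0: "CAT0_space M d" and complete: "Metric_space.mcomplete M d"
    and dim: "covering_dim_le (Metric_space.mtopology M d) (card (carrier B) - 1)"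
    and act: "group_action (wreath_product A B) M \<phi>"
    and ss: "\<forall>g\<in>carrier (wreath_product A B). Metric_space.semisimple_isometry M d (\<phi> g)"
  let ?G = "wreath_product A B"
  have groupA: "group A" using assms(1) by (simp add: finitely_generated_group_def)
  interpret CAT0_space M d by fact
  interpret group_action ?G M \<phi> by fact
  interpret B: group B by fact
  note wr = groupA assms(3,4)
  let ?n = "card (carrier B)"
  \<comment> \<open>The subtraction is truncated, so \<open>B\<close> having an element matters
    here.\<close>
  have n: "?n - 1 < ?n"
  proof -
    have "0 < ?n" unfolding card_gt_0_iff using assms(4) B.one_closed by blast
    then show ?thesis by simp
  qed
  obtain b where b: "bij_betw b {0..<?n} (carrier B)"
    using ex_bij_betw_nat_finite[OF assms(4)] by blast
  have bB: "b i \<in> carrier B" if "i < ?n" for i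
    using bij_betwE[OF b] that by simp
  have b_surj: "\<exists>i<?n. c = b i" if "c \<in> carrier B" for c
    using bij_betw_imp_surj_on[OF b] that by force
  have b_neq: "b i \<noteq> b j" if "i < ?n" "j < ?n" "i \<noteq> j" for i j
    using bij_betw_imp_inj_on[OF b] that by (auto simp: inj_on_def)
  let ?\<iota> = "base_embedding A B" and ?\<beta> = "top_embedding A"
  have \<iota>G: "?\<iota> c a \<in> carrier ?G" if "a \<in> carrier A" for c a
    using hom_in_carrier[OF base_embedding_hom[OF wr] that] .
  have \<beta>G: "?\<beta> B c \<in> carrier ?G" if "c \<in> carrier B" for c
    using hom_in_carrier[OF top_embedding_hom[OF wr] that] .
  have iso: "isometry_of (\<phi> g)" if "g \<in> carrier ?G" for g
    using ss that by (simp add: semisimple_isometry_def)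
  define T where "T i = (\<lambda>a. \<phi> (?\<iota> (b i) a)) ` carrier A" for i
  have T_iso: "isometry_of g" if "g \<in> T i" for g i
    using that iso[OF \<iota>G] by (auto simp: T_def)
  have comm: "\<phi> (?\<iota> (b i) a) (\<phi> (?\<iota> (b j) a') x) = \<phi> (?\<iota> (b j) a') (\<phi> (?\<iota> (b i) a) x)"
    if "i < ?n" "j < ?n" "i \<noteq> j" "a \<in> carrier A" "a' \<in> carrier A" "x \<in> M" for i j a a' x
    using composition_rule[OF that(6) \<iota>G \<iota>G] base_embedding_commute[OF wr b_neq] that by metis
  have "\<exists>i<?n. fixed_points (T i) \<noteq> {}"
    unfolding T_def
  proof (rule commuting_actions_fixed_point[OF complete dim n assms(1,2)])
    show "group_action A M (\<lambda>a. \<phi> (?\<iota> (b i) a))" for i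
      by (rule group_action_compose_hom[OF act groupA base_embedding_hom[OF wr]])
    show "semisimple_isometry (\<phi> (?\<iota> (b i) a))" if "a \<in> carrier A" for i a
      using ss \<iota>G[OF that] by blast
  qed (rule comm)
  then obtain i x where i: "i < ?n" and x: "x \<in> fixed_points (T i)" by blast
  have xM: "x \<in> M" using x by (simp add: fixed_points_def)
  have "fixed_points (T j) \<noteq> {}" if j: "j < ?n" for j
  proof -
    \<comment> \<open>The element of \<open>B\<close> that moves the copy at \<open>b i\<close>,
      where a fixed point is known, to the copy at \<open>b j\<close>.\<close>
    define c where "c = b j \<otimes>\<^bsub>B\<^esub> inv\<^bsub>B\<^esub> b i"
    have c: "c \<in> carrier B" "c \<otimes>\<^bsub>B\<^esub> b i = b j"
      using bB[OF i] bB[OF j] by (simp_all add: c_def B.m_assoc)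
    have "\<phi> (?\<iota> (b j) a) (\<phi> (?\<beta> B c) x) = \<phi> (?\<beta> B c) x" if a: "a \<in> carrier A" for a
    proof -
      have "\<phi> (?\<iota> (b j) a) (\<phi> (?\<beta> B c) x) = \<phi> (?\<beta> B c \<otimes>\<^bsub>?G\<^esub> ?\<iota> (b i) a) x"
        using composition_rule[OF xM \<iota>G[OF a] \<beta>G[OF c(1)]]
          top_base_embedding[OF wr c(1) bB[OF i] a] c(2) by simp
      also have "\<dots> = \<phi> (?\<beta> B c) (\<phi> (?\<iota> (b i) a) x)"
        by (rule composition_rule[OF xM \<beta>G[OF c(1)] \<iota>G[OF a]])
      also have "\<phi> (?\<iota> (b i) a) x = x"
        by (rule fixed_pointsD[OF x]) (use a in \<open>simp add: T_def\<close>)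
      finally show ?thesis .
    qed
    then have "\<phi> (?\<beta> B c) x \<in> fixed_points (T j)"
      using isometry_of_closed[OF iso[OF \<beta>G[OF c(1)]] xM] by (auto simp: fixed_points_def T_def)
    then show ?thesis by blast
  qed
  then have D_ne: "fixed_points (\<Union>i<?n. T i) \<noteq> {}"
    by (intro commuting_fixed_points[OF complete T_iso]) (auto simp: T_def comm)
  define D where "D = fixed_points (\<Union>i<?n. T i)"
  have D: "closed_convex D"
    unfolding D_def by (rule closed_convex_fixed_points) (use T_iso in blast)
  have D_iff: "y \<in> D \<longleftrightarrow> y \<in> M \<and> (\<forall>c\<in>carrier B. \<forall>a\<in>carrier A. \<phi> (?\<iota> c a) y = y)" for y
    using b_surj bB by (fastforce simp: D_def fixed_points_def T_def)
  obtain z where z: "z \<in> D" "z \<in> M" using D_ne D_iff D_def by blast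
  \<comment> \<open>The orbit of \<open>z\<close> under \<open>B\<close> is finite and permuted by
    \<open>B\<close>; minimising over \<open>D\<close> keeps the resulting point fixed by all copies
    of \<open>A\<close>.\<close>
  define P where "P = (\<lambda>c. \<phi> (?\<beta> B c) z) ` carrier B"
  have \<beta>_mult: "\<phi> (?\<beta> B c) (\<phi> (?\<beta> B c') y) = \<phi> (?\<beta> B (c \<otimes>\<^bsub>B\<^esub> c')) y"
    if "c \<in> carrier B" "c' \<in> carrier B" "y \<in> M" for c c' y
    using composition_rule[OF that(3) \<beta>G \<beta>G] hom_mult[OF top_embedding_hom[OF wr]] that by simp
  have "fixed_points ((\<lambda>c. \<phi> (?\<beta> B c)) ` carrier B) \<inter> D \<noteq> {}"
  proof (rule fixed_point_in_closed_convex[OF complete D, of P])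
    show "D \<noteq> {}" using z by blast
    show "finite P" using assms(4) by (simp add: P_def)
    show "P \<noteq> {}" using B.one_closed by (auto simp: P_def)
    show "P \<subseteq> M" using z isometry_of_closed[OF iso[OF \<beta>G]] by (auto simp: P_def)
    fix g assume "g \<in> (\<lambda>c. \<phi> (?\<beta> B c)) ` carrier B"
    then obtain c where c: "c \<in> carrier B" "g = \<phi> (?\<beta> B c)" by blast
    show "isometry_of g" using c iso \<beta>G by simp
    have "g ` P = (\<lambda>c'. \<phi> (?\<beta> B c') z) ` ((\<lambda>c'. c \<otimes>\<^bsub>B\<^esub> c') ` carrier B)"
      using \<beta>_mult[OF c(1) _ z(2)] by (simp add: P_def image_image c(2))
    also have "(\<lambda>c'. c \<otimes>\<^bsub>B\<^esub> c') ` carrier B = carrier B"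
      using B.surj_const_mult[OF c(1)] .
    finally show "g ` P = P" by (simp add: P_def)
    show "g ` D \<subseteq> D"
    proof
      fix w assume "w \<in> g ` D"
      then obtain y where y: "y \<in> D" "w = g y" by blast
      then have yM: "y \<in> M" by (simp add: D_iff)
      have "\<phi> (?\<iota> c' a) w = w" if "c' \<in> carrier B" and a: "a \<in> carrier A" for c' a
      proof -
        \<comment> \<open>\<open>c\<close> moves the copy at \<open>c''\<close> to the copy at
          \<open>c'\<close>, so the claim for \<open>w\<close> reduces to \<open>y\<close> being
          fixed by the copy at \<open>c''\<close>.\<close>
        define c'' where "c'' = inv\<^bsub>B\<^esub> c \<otimes>\<^bsub>B\<^esub> c'"
        have c'': "c'' \<in> carrier B" "c \<otimes>\<^bsub>B\<^esub> c'' = c'"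
          using c(1) that by (simp_all add: c''_def B.m_assoc[symmetric])
        have "\<phi> (?\<iota> c' a) w = \<phi> (?\<beta> B c \<otimes>\<^bsub>?G\<^esub> ?\<iota> c'' a) y"
          using composition_rule[OF yM \<iota>G[OF a] \<beta>G[OF c(1)]]
            top_base_embedding[OF wr c(1) c''(1) a] c''(2) y(2) c(2) by simp
        also have "\<dots> = w"
          using composition_rule[OF yM \<beta>G[OF c(1)] \<iota>G[OF a]] y c(2) c''(1) a by (simp add: D_iff)
        finally show ?thesis .
      qed
      moreover have "w \<in> M" using isometry_of_closed[OF iso[OF \<beta>G[OF c(1)]] yM] y(2) c(2) by simp
      ultimately show "w \<in> D" by (simp add: D_iff)
    qed
  qed
  then obtain y where y: "y \<in> fixed_points ((\<lambda>c. \<phi> (?\<beta> B c)) ` carrier B)" "y \<in> D" by blast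
  have yM: "y \<in> M" using y(2) by (simp add: D_iff)
  have "\<phi> g y = y" if "g \<in> carrier ?G" for g
  proof (rule wreath_product_induct[OF wr that, where P = "\<lambda>g. \<phi> g y = y"])
    show "\<phi> (?\<iota> c a) y = y" if "c \<in> carrier B" "a \<in> carrier A" for c a
      using y(2) that by (simp add: D_iff)
    show "\<phi> (?\<beta> B c) y = y" if "c \<in> carrier B" for c
      using that by (intro fixed_pointsD[OF y(1)]) simp
    show "\<phi> (g \<otimes>\<^bsub>?G\<^esub> h) y = y"
      if "g \<in> carrier ?G" "h \<in> carrier ?G" "\<phi> g y = y" "\<phi> h y = y" for g h
      using composition_rule[OF yM that(1,2)] that(3,4) by simp
  qed
  with yM show "\<exists>x\<in>M. \<forall>g\<in>carrier ?G. \<phi> g x = x" by blast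
qed

end
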